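(* Let $n\ge3$ and let $\mathcal H$ be the arrangement of type $B_n$ in $\mathbb C^n$ consisting of the hyperplanes $H_i=(z_i=0)$, $1\le i\le n$, and $H_{i,\pm j}=(z_i\pm z_j=0)$, $1\le i<j\le n$. Let $\mu_1,\dots,\mu_n$ be positive real numbers and let $a\in\mathbb C$. Then relative to this arrangement and the inner product defined by $\langle e_i,e_j\rangle=\mu_i\delta_{i,j}$ on the standard basis, the exponents $\kappa_{i,\pm j}:=\mu_i+\mu_j$, $\kappa_i:=a+2\mu_i$ define a Dunkl form. In this case $\kappa_0=a+2\sum_i\mu_i$. Any Dunkl form for $\mathcal H$ is proportional to one of this kind for certain $\mu_1,\dots,\mu_n;a$. In particular, it is always invariant under reflection in the mirrors of the short roots (the transformations $z_i\mapsto-z_i$).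
   Context: Let $V$ be a complex vector space with a positive definite hermitian inner product and $\mathcal H$ a finite set of linear hyperplanes, $V^\circ=V\setminus\bigcup_{H\in\mathcal H}H$. Exponents $\kappa\in\mathbb C^{\mathcal H}$ define a Dunkl form $\Omega=\sum_{H\in\mathcal H}\omega_H\otimes\kappa_H\pi_H$ (relative to the inner product) if the connection $\nabla^0-\Omega$ on the tangent bundle of $V^\circ$ is flat; here $\omega_H=\phi_H^{-1}d\phi_H$ with $\phi_H$ a linear equation of $H$, $\pi_H$ is the orthogonal projection with kernel $H$ and $\nabla^0$ is the translation invariant connection. In the classification statement, "any Dunkl form for $\mathcal H$" refers to such forms with all $\kappa_H\neq0$ relative to an arbitrary positive definite inner product on $\mathbb C^n$; proportional means equal up to a complex scalar factor. $\kappa_0=\frac1{\dim V}\sum_{H\in\mathcal H}\kappa_H$. In the claim $\kappa_i=\kappa_{H_i}$ and $\kappa_{i,\pm j}=\kappa_{H_{i,\pm j}}$. *)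

theory Defs
  imports "HOL-Analysis.Analysis"
begin

text \<open>Throughout, the complex vector space is coordinatised as \<open>complex ^ 'n\<close>, with complex
  scalar multiplication \<open>*s\<close>; the hermitian inner product is a parameter \<open>h\<close>.\<close>

definition pos_def_hermitian :: "(complex^'n \<Rightarrow> complex^'n \<Rightarrow> complex) \<Rightarrow> bool" where
  "pos_def_hermitian h \<longleftrightarrow>
     (\<forall>x y z. h (x + y) z = h x z + h y z) \<and>
     (\<forall>c x y. h (c *s x) y = c * h x y) \<and>
     (\<forall>x y. h y x = cnj (h x y)) \<and>
     (\<forall>x. x \<noteq> 0 \<longrightarrow> h x x \<in> \<real> \<and> Re (h x x) > 0)"

definition linear_equation :: "(complex^'n) set \<Rightarrow> (complex^'n \<Rightarrow> complex) \<Rightarrow> bool" where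
  "linear_equation H \<phi> \<longleftrightarrow>
     Vector_Spaces.linear (*s) (*) \<phi> \<and> (\<exists>v. \<phi> v \<noteq> 0) \<and> H = {z. \<phi> z = 0}"

definition is_hyperplane :: "(complex^'n) set \<Rightarrow> bool" where
  "is_hyperplane H \<longleftrightarrow> (\<exists>\<phi>. linear_equation H \<phi>)"

definition arr_complement :: "(complex^'n) set set \<Rightarrow> (complex^'n) set" where
  "arr_complement \<H> = UNIV - \<Union>\<H>"

text \<open>\<open>omega H z v\<close> is the value at \<open>z\<close> on the tangent vector \<open>v\<close> of the logarithmic form
  \<open>\<phi>\<inverse> d\<phi>\<close>. Since \<open>\<phi>\<close> is linear, its differential at every point is \<open>\<phi>\<close> itself; the quotient
  does not depend on which equation \<open>\<phi>\<close> of \<open>H\<close> is chosen.\<close>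

definition omega :: "(complex^'n) set \<Rightarrow> complex^'n \<Rightarrow> complex^'n \<Rightarrow> complex" where
  "omega H z v = (let \<phi> = (SOME \<phi>. linear_equation H \<phi>) in \<phi> v / \<phi> z)"

text \<open>The \<open>h\<close>-orthogonal projection with kernel \<open>H\<close>: the component of \<open>v\<close> that is orthogonal
  to \<open>H\<close>.\<close>

definition orth_proj ::
  "(complex^'n \<Rightarrow> complex^'n \<Rightarrow> complex) \<Rightarrow> (complex^'n) set \<Rightarrow> complex^'n \<Rightarrow> complex^'n" where
  "orth_proj h H v = (THE p. (\<forall>x\<in>H. h x p = 0) \<and> v - p \<in> H)"

text \<open>\<open>\<Omega> = \<Sum>\<^sub>H \<omega>\<^sub>H \<otimes> \<kappa>\<^sub>H \<pi>\<^sub>H\<close> as an endomorphism-valued 1-form: base point \<open>z\<close>, tangent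
  vector \<open>v\<close>, and the vector \<open>w\<close> to which the resulting endomorphism is applied.\<close>

definition Omega ::
  "(complex^'n \<Rightarrow> complex^'n \<Rightarrow> complex) \<Rightarrow> (complex^'n) set set \<Rightarrow> ((complex^'n) set \<Rightarrow> complex)
    \<Rightarrow> complex^'n \<Rightarrow> complex^'n \<Rightarrow> complex^'n \<Rightarrow> complex^'n" where
  "Omega h \<H> \<kappa> z v w = (\<Sum>H\<in>\<H>. (omega H z v * \<kappa> H) *s orth_proj h H w)"

text \<open>A vector field on an open set \<open>U\<close> is a function whose values outside \<open>U\<close> are irrelevant.
  \<open>covariant A X Y\<close> is \<open>\<nabla>\<^sub>X Y\<close> for \<open>\<nabla> = \<nabla>\<^sup>0 - A\<close>, where \<open>\<nabla>\<^sup>0\<^sub>X Y\<close> is the directional derivative.\<close>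

definition covariant ::
  "('v::real_normed_vector \<Rightarrow> 'v \<Rightarrow> 'v \<Rightarrow> 'v) \<Rightarrow> ('v \<Rightarrow> 'v) \<Rightarrow> ('v \<Rightarrow> 'v) \<Rightarrow> 'v \<Rightarrow> 'v" where
  "covariant A X Y z = frechet_derivative Y (at z) (X z) - A z (X z) (Y z)"

definition lie_bracket ::
  "('v::real_normed_vector \<Rightarrow> 'v) \<Rightarrow> ('v \<Rightarrow> 'v) \<Rightarrow> 'v \<Rightarrow> 'v" where
  "lie_bracket X Y z = frechet_derivative Y (at z) (X z) - frechet_derivative X (at z) (Y z)"

definition curvature ::
  "('v::real_normed_vector \<Rightarrow> 'v \<Rightarrow> 'v \<Rightarrow> 'v) \<Rightarrow> ('v \<Rightarrow> 'v) \<Rightarrow> ('v \<Rightarrow> 'v) \<Rightarrow> ('v \<Rightarrow> 'v) \<Rightarrow> 'v \<Rightarrow> 'v" where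
  "curvature A X Y Z z =
     covariant A X (covariant A Y Z) z - covariant A Y (covariant A X Z) z
       - covariant A (lie_bracket X Y) Z z"

definition twice_differentiable_on ::
  "('v::real_normed_vector \<Rightarrow> 'v) \<Rightarrow> 'v set \<Rightarrow> bool" where
  "twice_differentiable_on f U \<longleftrightarrow>
     (\<exists>f' :: 'v \<Rightarrow> 'v \<Rightarrow>\<^sub>L 'v. \<forall>z\<in>U. (f has_derivative blinfun_apply (f' z)) (at z) \<and>
        f' differentiable (at z))"

text \<open>Flatness of \<open>\<nabla>\<^sup>0 - A\<close> on the open set \<open>U\<close> is vanishing of the curvature. As the curvature
  is a tensor, its vanishing does not depend on the regularity class (holomorphic, smooth or, as
  here, twice differentiable) of the test fields; two derivatives are what makes the expression
  meaningful.\<close>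

definition flat_connection_on ::
  "('v::real_normed_vector) set \<Rightarrow> ('v \<Rightarrow> 'v \<Rightarrow> 'v \<Rightarrow> 'v) \<Rightarrow> bool" where
  "flat_connection_on U A \<longleftrightarrow>
     (\<forall>X Y Z. twice_differentiable_on X U \<and> twice_differentiable_on Y U \<and>
        twice_differentiable_on Z U \<longrightarrow> (\<forall>z\<in>U. curvature A X Y Z z = 0))"

definition dunkl_form ::
  "(complex^'n \<Rightarrow> complex^'n \<Rightarrow> complex) \<Rightarrow> (complex^'n) set set \<Rightarrow> ((complex^'n) set \<Rightarrow> complex)
    \<Rightarrow> bool" where
  "dunkl_form h \<H> \<kappa> \<longleftrightarrow>
     pos_def_hermitian h \<and> finite \<H> \<and> (\<forall>H\<in>\<H>. is_hyperplane H) \<and>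
     flat_connection_on (arr_complement \<H>) (Omega h \<H> \<kappa>)"

definition kappa_0 :: "(complex^'n) set set \<Rightarrow> ((complex^'n) set \<Rightarrow> complex) \<Rightarrow> complex" where
  "kappa_0 \<H> \<kappa> = (\<Sum>H\<in>\<H>. \<kappa> H) / of_nat CARD('n)"

definition H_coord :: "'n \<Rightarrow> (complex^'n) set" where
  "H_coord i = {z. z $ i = 0}"

definition H_plus :: "'n \<Rightarrow> 'n \<Rightarrow> (complex^'n) set" where
  "H_plus i j = {z. z $ i + z $ j = 0}"

definition H_minus :: "'n \<Rightarrow> 'n \<Rightarrow> (complex^'n) set" where
  "H_minus i j = {z. z $ i - z $ j = 0}"

text \<open>\<open>H_plus\<close> and \<open>H_minus\<close> are symmetric in their arguments, so letting \<open>i \<noteq> j\<close> range over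
  ordered pairs gives the same set of hyperplanes as \<open>i < j\<close>.\<close>

definition B_arrangement :: "(complex^'n) set set" where
  "B_arrangement = {H_coord i | i. True} \<union> {H_plus i j | i j. i \<noteq> j} \<union> {H_minus i j | i j. i \<noteq> j}"

text \<open>The inner product with \<open>\<langle>e\<^sub>i, e\<^sub>j\<rangle> = \<mu>\<^sub>i \<delta>\<^sub>i\<^sub>j\<close>.\<close>

definition diag_inner :: "('n \<Rightarrow> real) \<Rightarrow> complex^'n \<Rightarrow> complex^'n \<Rightarrow> complex" where
  "diag_inner \<mu> x y = (\<Sum>i\<in>UNIV. complex_of_real (\<mu> i) * x $ i * cnj (y $ i))"

lemma diag_inner_axis: "diag_inner \<mu> (axis i 1) (axis j 1) = (if i = j then complex_of_real (\<mu> i) else 0)"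
proof -
  have "diag_inner \<mu> (axis i 1) (axis j 1) =
      (\<Sum>k\<in>UNIV. if k = i then (if i = j then complex_of_real (\<mu> i) else 0) else 0)"
    unfolding diag_inner_def by (rule sum.cong) (auto simp: axis_def)
  then show ?thesis by simp
qed

definition B_exponents :: "('n \<Rightarrow> real) \<Rightarrow> complex \<Rightarrow> ((complex^'n) set \<Rightarrow> complex) \<Rightarrow> bool" where
  "B_exponents \<mu> a \<kappa> \<longleftrightarrow>
     (\<forall>i. \<kappa> (H_coord i) = a + 2 * complex_of_real (\<mu> i)) \<and>
     (\<forall>i j. i \<noteq> j \<longrightarrow> \<kappa> (H_plus i j) = complex_of_real (\<mu> i) + complex_of_real (\<mu> j) \<and>
        \<kappa> (H_minus i j) = complex_of_real (\<mu> i) + complex_of_real (\<mu> j))"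

text \<open>The prescription is consistent, that is, the hyperplanes are distinct for distinct indices:
  the vector \<open>e\<^sub>k\<close> lies outside exactly those hyperplanes whose equation involves \<open>z\<^sub>k\<close>.\<close>

lemma B_exponents_exist:
  fixes \<mu> :: "'n::finite \<Rightarrow> real"
  shows "\<exists>\<kappa>. B_exponents \<mu> a \<kappa>"
proof -
  define K :: "(complex^'n) set \<Rightarrow> 'n set" where "K H = {k. axis k 1 \<notin> H}" for H
  define \<kappa> where "\<kappa> H = (if card (K H) = 1 then a + 2 * (\<Sum>k\<in>K H. complex_of_real (\<mu> k))
     else (\<Sum>k\<in>K H. complex_of_real (\<mu> k)))" for H
  have "K (H_coord i) = {i}" for i
    by (auto simp: K_def H_coord_def axis_def)
  moreover have "K (H_plus i j) = {i, j}" "K (H_minus i j) = {i, j}" if "i \<noteq> j" for i j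
    using that by (auto simp: K_def H_plus_def H_minus_def axis_def)
  ultimately have "B_exponents \<mu> a \<kappa>"
    unfolding B_exponents_def \<kappa>_def by simp
  then show ?thesis by blast
qed

definition sign_change :: "'n \<Rightarrow> complex^'n \<Rightarrow> complex^'n" where
  "sign_change i z = (\<chi> j. if j = i then - (z $ j) else z $ j)"

text \<open>Equality of \<open>A\<close> on \<open>U\<close> with its transform under the linear involution \<open>g\<close> (acting on points
  and tangent vectors, and on endomorphisms by conjugation).\<close>

definition form_invariant_on ::
  "'v set \<Rightarrow> ('v \<Rightarrow> 'v) \<Rightarrow> ('v \<Rightarrow> 'v \<Rightarrow> 'v \<Rightarrow> 'v) \<Rightarrow> bool" where
  "form_invariant_on U g A \<longleftrightarrow>
     g ` U = U \<and> (\<forall>z\<in>U. \<forall>v w. A (g z) (g v) (g w) = g (A z v w))"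

end

theory Submission
  imports Defs
begin

text \<open>
The form \<open>\<Omega>\<close> is closed, so the curvature of \<open>\<nabla>\<^sup>0 - \<Omega>\<close> is the commutator of the values of \<open>\<Omega>\<close>
(\<open>curvature_eq_commutator\<close>), and flatness means that at each point of the complement the endomorphisms
\<open>\<Omega>\<^sub>z(u)\<close> commute (\<open>flat_connection_Omega_iff\<close>). For test fields that are merely twice differentiable
this rests on the symmetry of the second derivative.

For the inner product with parameters \<open>\<mu>\<^sub>i\<close> and the prescribed exponents, the factor \<open>\<mu>\<^sub>i + \<mu>\<^sub>j\<close>
cancels the denominator of the projection, and the matrix of \<open>\<Omega>\<^sub>z(v)\<close> becomes explicit, with
denominators \<open>z\<^sub>i\<close> and \<open>z\<^sub>i\<^sup>2 - z\<^sub>j\<^sup>2\<close>. Two such matrices commute by an identity in each pair and an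
identity in each triple of coordinates (\<open>B_matrix_commute\<close>). The same matrix shows the invariance
under sign changes (\<open>form_invariant_B\<close>).

Conversely, suppose that \<open>\<Omega>\<close> is a Dunkl form without zero exponents. If \<open>H\<close> is a mirror and \<open>L\<close> an
intersection of two mirrors contained in \<open>H\<close>, taking residues along \<open>H\<close> and then along \<open>L\<close> shows that
\<open>\<pi>\<^sub>H\<close> commutes with the sum of \<open>\<kappa>\<^sub>K \<pi>\<^sub>K\<close> over the other mirrors \<open>K\<close> that contain \<open>L\<close>
(\<open>residue_commutes\<close>). Three kinds of \<open>L\<close> determine everything.
Those given by \<open>z\<^sub>i = 0\<close>, \<open>z\<^sub>j = \<plusminus>z\<^sub>k\<close> lie on two mirrors only, whose normals must be orthogonal;
therefore the inner product is diagonal, and this defines \<open>\<mu>\<close> (\<open>diagonal_inner_product\<close>).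
Those given by \<open>z\<^sub>i = \<plusminus>z\<^sub>j = \<plusminus>z\<^sub>k\<close> show that the quotient of the exponent of \<open>z\<^sub>i = \<plusminus>z\<^sub>j\<close> by
\<open>\<mu>\<^sub>i + \<mu>\<^sub>j\<close> is a constant \<open>c\<close> (\<open>ratio_triple\<close>, \<open>ratio_constant\<close>).
Those given by \<open>z\<^sub>i = z\<^sub>j = 0\<close> show that the exponents of \<open>z\<^sub>i = 0\<close> and \<open>z\<^sub>j = 0\<close> differ by
\<open>2 c (\<mu>\<^sub>i - \<mu>\<^sub>j)\<close> (\<open>kappa_H_coord_diff\<close>).
So \<open>\<Omega>\<close> is \<open>c\<close> times a form of the prescribed kind, and inherits its invariance.
\<close>

section \<open>Symmetry of the second derivative\<close>

text \<open>Write \<open>g(x) = f(z + x d + t e) - f(z + x d)\<close>. Linearising \<open>f'\<close> at \<open>z\<close> shows that the derivative of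
\<open>g\<close> is \<open>t f''(e)(d)\<close> up to an error \<open>o(t)\<close>, uniformly for \<open>x\<close> in \<open>[0, t]\<close>, and the mean value
inequality turns this into an estimate of \<open>g(t) - g(0)\<close>.\<close>
lemma second_difference_estimate:
  fixes f :: "'a::real_normed_vector \<Rightarrow> 'b::real_normed_vector"
  assumes "open U" "z \<in> U"
    and f': "\<And>y. y \<in> U \<Longrightarrow> (f has_derivative blinfun_apply (f' y)) (at y)"
    and f'': "(f' has_derivative f'') (at z)"
    and "\<epsilon> > 0"
  shows "\<exists>\<delta>>0. \<forall>t. 0 < t \<and> t < \<delta> \<longrightarrow>
    norm (f (z + t *\<^sub>R d + t *\<^sub>R e) - f (z + t *\<^sub>R d) - f (z + t *\<^sub>R e) + f z
      - t\<^sup>2 *\<^sub>R blinfun_apply (f'' e) d) \<le> \<epsilon> * t\<^sup>2"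
proof -
  define C where "C = 1 + norm d + norm e"
  have C: "C > 0" by (simp add: C_def add_pos_nonneg)
  \<comment> \<open>The derivative of the difference will carry two linearisation errors, each at most \<open>\<eta> t C\<close>,
    and is applied to \<open>d\<close>, of norm at most \<open>C\<close>.\<close>
  define \<eta> where "\<eta> = \<epsilon> / (2 * C\<^sup>2)"
  have \<eta>: "\<eta> > 0" using C assms(5) by (simp add: \<eta>_def)
  obtain r where r: "r > 0" "ball z r \<subseteq> U"
    using assms(1,2) openE by blast
  have lin: "linear f''" using f'' has_derivative_linear by blast
  obtain s where s: "s > 0"
    "\<And>y. norm (y - z) < s \<Longrightarrow> norm (f' y - f' z - f'' (y - z)) \<le> \<eta> * norm (y - z)"
    using f'' \<eta> unfolding has_derivative_at_alt by blast
  define \<delta> where "\<delta> = min r s / C"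
  have "norm (f (z + t *\<^sub>R d + t *\<^sub>R e) - f (z + t *\<^sub>R d) - f (z + t *\<^sub>R e) + f z
      - t\<^sup>2 *\<^sub>R blinfun_apply (f'' e) d) \<le> \<epsilon> * t\<^sup>2" if t: "0 < t" "t < \<delta>" for t
  proof -
    have tC: "t * C < r" "t * C < s"
      using t C by (auto simp: \<delta>_def field_simps)
    have small: "norm (x *\<^sub>R d + y *\<^sub>R e) \<le> t * C" if "0 \<le> x" "x \<le> t" "0 \<le> y" "y \<le> t" for x y
    proof -
      have "norm (x *\<^sub>R d + y *\<^sub>R e) \<le> x * norm d + y * norm e"
        using norm_triangle_ineq[of "x *\<^sub>R d" "y *\<^sub>R e"] that by simp
      also have "\<dots> \<le> t * norm d + t * norm e"
        using that by (intro add_mono mult_right_mono) auto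
      also have "\<dots> \<le> t * C" using t by (simp add: C_def algebra_simps)
      finally show ?thesis .
    qed
    have inU: "z + x *\<^sub>R d + y *\<^sub>R e \<in> U" if "0 \<le> x" "x \<le> t" "0 \<le> y" "y \<le> t" for x y
    proof -
      have "dist z (z + x *\<^sub>R d + y *\<^sub>R e) = norm (x *\<^sub>R d + y *\<^sub>R e)"
        by (metis add.assoc add_diff_cancel_left' dist_norm norm_minus_commute)
      then show ?thesis using small[OF that] tC r(2) by (metis mem_ball subsetD le_less_trans)
    qed
    have lin_approx: "norm (f' (z + x *\<^sub>R d + y *\<^sub>R e) - f' z - f'' (x *\<^sub>R d + y *\<^sub>R e)) \<le> \<eta> * (t * C)"
      if "0 \<le> x" "x \<le> t" "0 \<le> y" "y \<le> t" for x y
    proof -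
      have "norm (f' (z + x *\<^sub>R d + y *\<^sub>R e) - f' z - f'' (x *\<^sub>R d + y *\<^sub>R e))
        \<le> \<eta> * norm (x *\<^sub>R d + y *\<^sub>R e)"
        using s(2)[of "z + x *\<^sub>R d + y *\<^sub>R e"] small[OF that] tC
        by (simp add: add.assoc)
      also have "\<dots> \<le> \<eta> * (t * C)" using small[OF that] \<eta> by simp
      finally show ?thesis .
    qed
    define k where "k x = f (z + x *\<^sub>R d + t *\<^sub>R e) - f (z + x *\<^sub>R d + 0 *\<^sub>R e)
       - x *\<^sub>R (t *\<^sub>R blinfun_apply (f'' e) d)" for x
    define k' where "k' x h = blinfun_apply (f' (z + x *\<^sub>R d + t *\<^sub>R e)) (h *\<^sub>R d)
       - blinfun_apply (f' (z + x *\<^sub>R d + 0 *\<^sub>R e)) (h *\<^sub>R d) - h *\<^sub>R (t *\<^sub>R blinfun_apply (f'' e) d)" for x h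
    have der: "(k has_derivative k' x) (at x within {0..t})" if "x \<in> {0..t}" for x
    proof -
      have 1: "((\<lambda>x. f (z + x *\<^sub>R d + y *\<^sub>R e)) has_derivative
        (\<lambda>h. blinfun_apply (f' (z + x *\<^sub>R d + y *\<^sub>R e)) (h *\<^sub>R d))) (at x within {0..t})"
        if "0 \<le> y" "y \<le> t" for y
        by (rule has_derivative_compose[where f="\<lambda>x. z + x *\<^sub>R d + y *\<^sub>R e" and g=f])
          (use that \<open>x \<in> {0..t}\<close> in \<open>auto intro!: derivative_eq_intros f' inU\<close>)
      show ?thesis unfolding k_def k'_def
        by (intro has_derivative_diff 1) (use t in \<open>auto intro!: derivative_eq_intros\<close>)
    qed
    have bound: "onorm (k' x) \<le> 2 * (\<eta> * (t * C)) * C" if x: "x \<in> {0..t}" for x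
    proof (rule onorm_bound)
      show "0 \<le> 2 * (\<eta> * (t * C)) * C" using \<eta> t C by simp
      fix h :: real
      let ?R = "\<lambda>y. f' (z + x *\<^sub>R d + y *\<^sub>R e) - f' z - f'' (x *\<^sub>R d + y *\<^sub>R e)"
      have "f'' (x *\<^sub>R d + t *\<^sub>R e) = f'' (x *\<^sub>R d + 0 *\<^sub>R e) + t *\<^sub>R f'' e"
        using lin by (simp add: linear_add linear_scale)
      then have "k' x h = h *\<^sub>R blinfun_apply (?R t - ?R 0) d"
        unfolding k'_def by (simp add: blinfun.bilinear_simps algebra_simps)
      then have "norm (k' x h) \<le> \<bar>h\<bar> * (norm (?R t - ?R 0) * norm d)"
        by (simp add: norm_blinfun mult_left_mono)
      also have "norm (?R t - ?R 0) \<le> 2 * (\<eta> * (t * C))"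
        using norm_triangle_ineq4[of "?R t" "?R 0"] lin_approx[of x t] lin_approx[of x 0] x t
        by auto
      also have "norm d \<le> C" by (simp add: C_def)
      finally show "norm (k' x h) \<le> 2 * (\<eta> * (t * C)) * C * norm h"
        using C t \<eta> by (simp add: mult.commute mult_left_mono mult_right_mono)
    qed
    have "norm (k t - k 0) \<le> 2 * (\<eta> * (t * C)) * C * norm (t - 0)"
      using t by (intro differentiable_bound[where S="{0..t}" and f'=k'] der bound) auto
    also have "\<dots> = \<epsilon> * t\<^sup>2"
      using t C by (simp add: \<eta>_def power2_eq_square field_simps)
    finally show ?thesis
      by (simp add: k_def power2_eq_square algebra_simps)
  qed
  moreover have "\<delta> > 0" using r s C by (simp add: \<delta>_def)
  ultimately show ?thesis by blast
qed

text \<open>The second difference is symmetric in the two increments, and divided by \<open>t\<^sup>2\<close> it tends to either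
side of the equation.\<close>
lemma symmetric_second_derivative:
  fixes f :: "'a::real_normed_vector \<Rightarrow> 'b::real_normed_vector"
  assumes "open U" "z \<in> U"
    and f': "\<And>y. y \<in> U \<Longrightarrow> (f has_derivative blinfun_apply (f' y)) (at y)"
    and f'': "(f' has_derivative f'') (at z)"
  shows "blinfun_apply (f'' d) e = blinfun_apply (f'' e) d"
proof -
  have "norm (blinfun_apply (f'' e) d - blinfun_apply (f'' d) e) \<le> \<epsilon>" if "\<epsilon> > 0" for \<epsilon>
  proof -
    have \<epsilon>2: "\<epsilon> / 2 > 0" using that by simp
    obtain a where a: "a > 0"
      and 1: "\<And>t. 0 < t \<Longrightarrow> t < a \<Longrightarrow> norm (f (z + t *\<^sub>R d + t *\<^sub>R e) - f (z + t *\<^sub>R d) - f (z + t *\<^sub>R e) + f z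
        - t\<^sup>2 *\<^sub>R blinfun_apply (f'' e) d) \<le> (\<epsilon>/2) * t\<^sup>2"
      using second_difference_estimate[OF assms \<epsilon>2, of d e] by blast
    obtain b where b: "b > 0"
      and 2: "\<And>t. 0 < t \<Longrightarrow> t < b \<Longrightarrow> norm (f (z + t *\<^sub>R e + t *\<^sub>R d) - f (z + t *\<^sub>R e) - f (z + t *\<^sub>R d) + f z
        - t\<^sup>2 *\<^sub>R blinfun_apply (f'' d) e) \<le> (\<epsilon>/2) * t\<^sup>2"
      using second_difference_estimate[OF assms \<epsilon>2, of e d] by blast
    define t where "t = min a b / 2"
    have t: "0 < t" "t < a" "t < b" using a b by (auto simp: t_def)
    define u where "u = f (z + t *\<^sub>R d + t *\<^sub>R e) - f (z + t *\<^sub>R d) - f (z + t *\<^sub>R e) + f z"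
    have u': "f (z + t *\<^sub>R e + t *\<^sub>R d) - f (z + t *\<^sub>R e) - f (z + t *\<^sub>R d) + f z = u"
      by (simp add: u_def add.assoc add.commute[of "t *\<^sub>R e"])
    define p where "p = blinfun_apply (f'' e) d"
    define q where "q = blinfun_apply (f'' d) e"
    have "norm (u - t\<^sup>2 *\<^sub>R p) \<le> (\<epsilon>/2) * t\<^sup>2" "norm (u - t\<^sup>2 *\<^sub>R q) \<le> (\<epsilon>/2) * t\<^sup>2"
      using 1[OF t(1,2)] 2[OF t(1,3)] by (simp_all only: u' u_def[symmetric] p_def q_def)
    then have "norm ((u - t\<^sup>2 *\<^sub>R q) - (u - t\<^sup>2 *\<^sub>R p)) \<le> \<epsilon> * t\<^sup>2"
      using norm_triangle_ineq4[of "u - t\<^sup>2 *\<^sub>R q" "u - t\<^sup>2 *\<^sub>R p"] by linarith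
    moreover have "(u - t\<^sup>2 *\<^sub>R q) - (u - t\<^sup>2 *\<^sub>R p) = t\<^sup>2 *\<^sub>R (p - q)"
      by (simp add: scaleR_diff_right)
    ultimately have "t\<^sup>2 * norm (p - q) \<le> t\<^sup>2 * \<epsilon>" by (simp add: mult.commute)
    then show ?thesis using t by (simp add: p_def q_def)
  qed
  then have "norm (blinfun_apply (f'' e) d - blinfun_apply (f'' d) e) \<le> 0"
    by (rule field_le_epsilon) simp
  then show ?thesis by simp
qed

section \<open>Curvature as a commutator\<close>

text \<open>The bilinear map \<open>D\<close> is the derivative of \<open>A\<close> in the base point. In the difference of the two
iterated covariant derivatives the second derivatives of \<open>Z\<close> cancel by symmetry, the derivatives
of \<open>X\<close> and \<open>Y\<close> are those of the bracket term, the mixed terms \<open>A(Y)(DZ X)\<close> occur twice with opposite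
signs, and the derivatives of \<open>A\<close> cancel because \<open>A\<close> is closed. Only the quadratic term in \<open>A\<close> is left.\<close>
lemma curvature_eq_commutator:
  fixes A :: "'v::real_normed_vector \<Rightarrow> 'v \<Rightarrow> 'v \<Rightarrow> 'v"
  assumes U: "open U" "z \<in> U"
    and X: "twice_differentiable_on X U" and Y: "twice_differentiable_on Y U"
    and Z: "twice_differentiable_on Z U"
    and lin: "\<And>w. linear (\<lambda>v. A z v w)" "\<And>v. linear (A z v)"
    and DA: "\<And>Y Z Y' Z'. (Y has_derivative Y') (at z) \<Longrightarrow> (Z has_derivative Z') (at z) \<Longrightarrow>
      ((\<lambda>x. A x (Y x) (Z x)) has_derivative
        (\<lambda>d. D d (Y z) (Z z) + A z (Y' d) (Z z) + A z (Y z) (Z' d))) (at z)"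
    and closed: "\<And>d v w. D d v w = D v d w"
  shows "curvature A X Y Z z = A z (X z) (A z (Y z) (Z z)) - A z (Y z) (A z (X z) (Z z))"
proof -
  obtain X' Y' Z' where
    X': "\<And>x. x \<in> U \<Longrightarrow> (X has_derivative blinfun_apply (X' x)) (at x)" and
    Y': "\<And>x. x \<in> U \<Longrightarrow> (Y has_derivative blinfun_apply (Y' x)) (at x)" and
    Z': "\<And>x. x \<in> U \<Longrightarrow> (Z has_derivative blinfun_apply (Z' x)) (at x)"
    and "Z' differentiable (at z)"
    using X Y Z U(2) unfolding twice_differentiable_on_def by blast
  then obtain Z'' where Z'': "(Z' has_derivative Z'') (at z)"
    by (auto simp: differentiable_def)
  have fd: "frechet_derivative X (at x) = blinfun_apply (X' x)"
    "frechet_derivative Y (at x) = blinfun_apply (Y' x)"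
    "frechet_derivative Z (at x) = blinfun_apply (Z' x)" if "x \<in> U" for x
    using X'[OF that] Y'[OF that] Z'[OF that] by (simp_all add: frechet_derivative_at[symmetric])
  have cov: "frechet_derivative (covariant A W Z) (at z) d =
      blinfun_apply (Z'' d) (W z) + blinfun_apply (Z' z) (blinfun_apply (W' z) d)
      - (D d (W z) (Z z) + A z (blinfun_apply (W' z) d) (Z z) + A z (W z) (blinfun_apply (Z' z) d))"
    if W: "\<And>x. x \<in> U \<Longrightarrow> (W has_derivative blinfun_apply (W' x)) (at x)" for W W' d
  proof -
    have "((\<lambda>x. blinfun_apply (Z' x) (W x) - A x (W x) (Z x)) has_derivative
      (\<lambda>d. blinfun_apply (Z' z) (blinfun_apply (W' z) d) + blinfun_apply (Z'' d) (W z)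
      - (D d (W z) (Z z) + A z (blinfun_apply (W' z) d) (Z z) + A z (W z) (blinfun_apply (Z' z) d)))) (at z)"
      by (intro has_derivative_diff DA blinfun.FDERIV Z'' W Z' U)
    then have "(covariant A W Z has_derivative
      (\<lambda>d. blinfun_apply (Z' z) (blinfun_apply (W' z) d) + blinfun_apply (Z'' d) (W z)
      - (D d (W z) (Z z) + A z (blinfun_apply (W' z) d) (Z z) + A z (W z) (blinfun_apply (Z' z) d)))) (at z)"
      by (rule has_derivative_transform_within_open[OF _ U]) (simp add: covariant_def fd)
    from frechet_derivative_at[OF this, symmetric] show ?thesis by simp
  qed
  have sym: "blinfun_apply (Z'' (X z)) (Y z) = blinfun_apply (Z'' (Y z)) (X z)"
    by (rule symmetric_second_derivative[OF U Z' Z''])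
  have cl: "D (X z) (Y z) (Z z) = D (Y z) (X z) (Z z)" by (rule closed)
  have l1: "A z (p - q) w = A z p w - A z q w" "A z v (p - q) = A z v p - A z v q" for p q w v
    using lin linear_diff by blast+
  have "covariant A W Z z = blinfun_apply (Z' z) (W z) - A z (W z) (Z z)" for W
    by (simp add: covariant_def fd U)
  moreover have "covariant A W V z = frechet_derivative V (at z) (W z) - A z (W z) (V z)" for V W
    by (rule covariant_def)
  ultimately show ?thesis
    unfolding curvature_def
    by (simp add: cov[OF X'] cov[OF Y'] lie_bracket_def fd U sym cl l1 blinfun.bilinear_simps)
qed

section \<open>Linear forms and orthogonal projections\<close>

lemma bounded_bilinear_vector_scalar_mult:
  "bounded_bilinear ((*s) :: complex \<Rightarrow> complex^'n \<Rightarrow> complex^'n)"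
proof
  show "\<exists>K. \<forall>a b. norm (a *s (b :: complex^'n)) \<le> norm a * norm b * K"
    by (rule exI[of _ 1]) (simp add: norm_vec_def norm_mult L2_set_right_distrib)
qed (auto simp: vec_eq_iff algebra_simps)

lemmas tendsto_vector_scalar_mult = bounded_bilinear.tendsto[OF bounded_bilinear_vector_scalar_mult]
lemmas has_derivative_vector_scalar_mult = bounded_bilinear.FDERIV[OF bounded_bilinear_vector_scalar_mult]

lemma scaleR_eq_vector_scalar_mult: "r *\<^sub>R (x :: complex^'n) = complex_of_real r *s x"
  by (simp add: vec_eq_iff scaleR_conv_of_real[where 'a=complex])

lemma bounded_linear_functional:
  fixes \<phi> :: "complex^'n \<Rightarrow> complex"
  assumes "Vector_Spaces.linear (*s) (*) \<phi>"
  shows "bounded_linear \<phi>"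
proof -
  interpret \<phi>: Vector_Spaces.linear "(*s)" "(*)" \<phi> by fact
  have "linear \<phi>"
    by (rule linearI) (simp_all add: \<phi>.add \<phi>.scale scaleR_eq_vector_scalar_mult scaleR_conv_of_real[where 'a=complex])
  then show ?thesis by (simp add: linear_conv_bounded_linear)
qed

lemma bounded_linear_endomorphism:
  fixes P :: "complex^'n \<Rightarrow> complex^'n"
  assumes "Vector_Spaces.linear (*s) (*s) P"
  shows "bounded_linear P"
proof -
  interpret P: Vector_Spaces.linear "(*s)" "(*s)" P by fact
  have "linear P"
    by (rule linearI) (simp_all add: P.add P.scale scaleR_eq_vector_scalar_mult)
  then show ?thesis by (simp add: linear_conv_bounded_linear)
qed

lemma linear_functional_expansion:
  fixes \<phi> :: "complex^'n \<Rightarrow> complex"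
  assumes "Vector_Spaces.linear (*s) (*) \<phi>"
  shows "\<phi> x = (\<Sum>i\<in>UNIV. x $ i * \<phi> (axis i 1))"
proof -
  interpret \<phi>: Vector_Spaces.linear "(*s)" "(*)" \<phi> by fact
  have "\<phi> x = \<phi> (\<Sum>i\<in>UNIV. x $ i *s axis i 1)" by (simp add: basis_expansion)
  then show ?thesis by (simp add: \<phi>.sum \<phi>.scale)
qed

text \<open>Two linear equations of the same hyperplane are proportional.\<close>
lemma omega_eq:
  assumes "linear_equation H \<phi>"
  shows "omega H z v = \<phi> v / \<phi> z"
proof -
  define \<psi> where "\<psi> = (SOME \<psi>. linear_equation H \<psi>)"
  have \<psi>: "linear_equation H \<psi>" unfolding \<psi>_def by (rule someI[of "linear_equation H"]) (rule assms)
  interpret \<phi>: Vector_Spaces.linear "(*s)" "(*)" \<phi> using assms by (simp add: linear_equation_def)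
  interpret \<psi>: Vector_Spaces.linear "(*s)" "(*)" \<psi> using \<psi> by (simp add: linear_equation_def)
  obtain e where e: "\<phi> e \<noteq> 0" using assms by (auto simp: linear_equation_def)
  have ker: "\<phi> x = 0 \<longleftrightarrow> \<psi> x = 0" for x
    using assms \<psi> by (auto simp: linear_equation_def)
  have "\<psi> x = \<psi> e / \<phi> e * \<phi> x" for x
  proof -
    have "\<phi> (x - (\<phi> x / \<phi> e) *s e) = 0" using e by (simp add: \<phi>.diff \<phi>.scale)
    then have "\<psi> (x - (\<phi> x / \<phi> e) *s e) = 0" by (simp add: ker)
    then show ?thesis by (simp add: \<psi>.diff \<psi>.scale)
  qed
  moreover have "\<psi> e / \<phi> e \<noteq> 0" using e ker by simp
  ultimately have "\<psi> v / \<psi> z = \<phi> v / \<phi> z" by (metis mult_divide_mult_cancel_left)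
  then show ?thesis by (simp add: omega_def Let_def \<psi>_def)
qed

context
  fixes h :: "complex^'n \<Rightarrow> complex^'n \<Rightarrow> complex"
  assumes h: "pos_def_hermitian h"
begin

lemma hermitian_add_left: "h (x + y) z = h x z + h y z"
proof -
  have "\<forall>x y z. h (x + y) z = h x z + h y z" using h unfolding pos_def_hermitian_def by (elim conjE)
  then show ?thesis by (elim allE)
qed

lemma hermitian_scale_left: "h (c *s x) z = c * h x z"
proof -
  have "\<forall>c x y. h (c *s x) y = c * h x y" using h unfolding pos_def_hermitian_def by (elim conjE)
  then show ?thesis by (elim allE)
qed

lemma hermitian_cnj: "h y x = cnj (h x y)"
proof -
  have "\<forall>x y. h y x = cnj (h x y)" using h unfolding pos_def_hermitian_def by (elim conjE)
  then show ?thesis by (elim allE)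
qed

lemma hermitian_self_eq_0_iff: "h x x = 0 \<longleftrightarrow> x = 0"
proof
  have "\<forall>x. x \<noteq> 0 \<longrightarrow> h x x \<in> \<real> \<and> Re (h x x) > 0"
    using h unfolding pos_def_hermitian_def by (elim conjE)
  then show "h x x = 0 \<Longrightarrow> x = 0" by (metis less_irrefl zero_complex.simps(1))
  show "x = 0 \<Longrightarrow> h x x = 0" using hermitian_scale_left[of 0 0 0] by simp
qed

lemma linear_hermitian: "Vector_Spaces.linear (*s) (*) (\<lambda>x. h x y)"
  by unfold_locales (simp_all add: hermitian_add_left hermitian_scale_left algebra_simps)

lemma hermitian_diff_left: "h (x - y) z = h x z - h y z"
  using hermitian_add_left[of "x - y" y z] by simp

lemma hermitian_add_right: "h z (x + y) = h z x + h z y"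
  using hermitian_cnj[of z "x + y"] hermitian_cnj[of z x] hermitian_cnj[of z y] hermitian_add_left[of x y z] by simp

lemma hermitian_scale_right: "h z (c *s x) = cnj c * h z x"
  using hermitian_cnj[of z "c *s x"] hermitian_cnj[of z x] hermitian_scale_left[of c x z] by simp

text \<open>The map sending \<open>y\<close> to the values of \<open>h _ y\<close> on the standard basis is conjugate linear and injective,
hence real linear and, by dimension, onto.\<close>
lemma riesz_representation:
  assumes "Vector_Spaces.linear (*s) (*) \<phi>"
  obtains y where "\<And>x. \<phi> x = h x y"
proof -
  note expand = linear_functional_expansion
  define F :: "complex^'n \<Rightarrow> complex^'n" where "F y = (\<chi> i. h (axis i 1) y)" for y
  have lin: "linear F"
    by (rule linearI)
      (simp_all add: F_def vec_eq_iff hermitian_add_right hermitian_scale_right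
        scaleR_eq_vector_scalar_mult)
  have "inj F"
    unfolding linear_injective_0[OF lin]
  proof (intro allI impI)
    fix y assume "F y = 0"
    then have "h (axis i 1) y = 0" for i by (simp add: F_def vec_eq_iff)
    then have "h y y = 0" using expand[OF linear_hermitian, of y y] by simp
    then show "y = 0" by (simp add: hermitian_self_eq_0_iff)
  qed
  then have "surj F" by (rule linear_injective_imp_surjective[OF lin]) simp
  then obtain y where "F y = (\<chi> i. \<phi> (axis i 1))" by (metis surjD)
  then have "h (axis i 1) y = \<phi> (axis i 1)" for i by (simp add: F_def vec_eq_iff)
  then have "\<phi> x = h x y" for x
    using expand[OF assms, of x] expand[OF linear_hermitian, of x y] by simp
  then show ?thesis using that by blast
qed

lemma orth_proj_eq:
  assumes "n \<noteq> 0"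
  shows "orth_proj h {x. h x n = 0} w = (h w n / h n n) *s n"
  unfolding orth_proj_def
proof (rule the_equality)
  have nn: "h n n \<noteq> 0" using assms hermitian_self_eq_0_iff by simp
  show "(\<forall>x\<in>{x. h x n = 0}. h x ((h w n / h n n) *s n) = 0) \<and> w - (h w n / h n n) *s n \<in> {x. h x n = 0}"
    using nn by (simp add: hermitian_scale_right hermitian_diff_left hermitian_scale_left)
  fix p assume p: "(\<forall>x\<in>{x. h x n = 0}. h x p = 0) \<and> w - p \<in> {x. h x n = 0}"
  define q where "q = (h w n / h n n) *s n"
  have d: "h (p - q) n = 0"
    using p nn by (simp add: q_def hermitian_diff_left hermitian_scale_left)
  have "h (p - q) p = 0" "h (p - q) q = 0"
    using p d by (auto simp: q_def hermitian_scale_right)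
  then have "h (p - q) (p - q) = 0"
    using hermitian_cnj[of p "p - q"] hermitian_cnj[of q "p - q"] hermitian_diff_left[of p q "p - q"] by simp
  then show "p = (h w n / h n n) *s n" by (simp add: hermitian_self_eq_0_iff q_def)
qed

lemma hyperplane_normal:
  assumes "is_hyperplane H"
  obtains n where "n \<noteq> 0" "H = {x. h x n = 0}"
proof -
  obtain \<phi> where \<phi>: "linear_equation H \<phi>" using assms by (auto simp: is_hyperplane_def)
  then obtain n where n: "\<And>x. \<phi> x = h x n"
    using riesz_representation by (metis linear_equation_def)
  have "n \<noteq> 0" using \<phi> n hermitian_scale_right[of _ 0 0] by (auto simp: linear_equation_def)
  with \<phi> n show ?thesis using that by (auto simp: linear_equation_def)
qed

end

section \<open>Flatness and residues of the form Omega\<close>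

lemma open_arr_complement:
  assumes "finite \<H>" "\<And>H. H \<in> \<H> \<Longrightarrow> is_hyperplane H"
  shows "open (arr_complement \<H>)"
proof -
  have "closed H" if H: "H \<in> \<H>" for H
  proof -
    obtain \<phi> where \<phi>: "linear_equation H \<phi>" using assms(2) H by (auto simp: is_hyperplane_def)
    then have "bounded_linear \<phi>" by (simp add: bounded_linear_functional linear_equation_def)
    then have "continuous_on UNIV \<phi>" by (rule linear_continuous_on)
    then have "closed {z \<in> UNIV. \<phi> z = 0}"
      by (intro continuous_closed_preimage_constant) auto
    then show ?thesis using \<phi> by (simp add: linear_equation_def)
  qed
  then have "closed (\<Union>\<H>)" using assms(1) by auto
  then show ?thesis by (simp add: arr_complement_def open_Diff)
qed

context
  fixes h :: "complex^'n \<Rightarrow> complex^'n \<Rightarrow> complex"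
  assumes h: "pos_def_hermitian h"
begin

lemma linear_orth_proj:
  assumes "is_hyperplane H"
  shows "Vector_Spaces.linear (*s) (*s) (orth_proj h H)"
proof -
  obtain n where n: "n \<noteq> 0" "H = {x. h x n = 0}" using hyperplane_normal[OF h assms] by blast
  show ?thesis
    unfolding n(2)
    by unfold_locales
      (simp_all add: orth_proj_eq[OF h n(1)] hermitian_add_left[OF h] hermitian_scale_left[OF h]
        vec_eq_iff algebra_simps add_divide_distrib)
qed

lemma has_derivative_log_term:
  assumes \<phi>: "Vector_Spaces.linear (*s) (*) \<phi>" "\<phi> z \<noteq> 0"
    and P: "Vector_Spaces.linear (*s) (*s) (P :: complex^'n \<Rightarrow> complex^'n)"
    and Y: "(Y has_derivative Y') (at z)" and Z: "(Z has_derivative Z') (at z)"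
  shows "((\<lambda>x. (\<phi> (Y x) / \<phi> x * c) *s P (Z x)) has_derivative
    (\<lambda>d. (- (\<phi> (Y z) * \<phi> d) / (\<phi> z * \<phi> z) * c) *s P (Z z)
        + (\<phi> (Y' d) / \<phi> z * c) *s P (Z z) + (\<phi> (Y z) / \<phi> z * c) *s P (Z' d))) (at z)"
proof -
  note bl = bounded_linear_functional[OF \<phi>(1)] bounded_linear_endomorphism[OF P]
  have 1: "((\<lambda>x. \<phi> (Y x)) has_derivative (\<lambda>d. \<phi> (Y' d))) (at z)"
    by (rule bounded_linear.has_derivative[OF bl(1) Y])
  have 2: "(\<phi> has_derivative \<phi>) (at z)"
    by (rule bounded_linear_imp_has_derivative[OF bl(1)])
  have 3: "((\<lambda>x. P (Z x)) has_derivative (\<lambda>d. P (Z' d))) (at z)"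
    by (rule bounded_linear.has_derivative[OF bl(2) Z])
  show ?thesis
    by (rule has_derivative_eq_rhs[OF has_derivative_vector_scalar_mult[OF
          has_derivative_mult_left[OF has_derivative_divide'[OF 1 2 \<phi>(2)]] 3]])
      (use \<phi>(2) in \<open>auto simp: fun_eq_iff vec_eq_iff field_simps\<close>)
qed

context
  fixes \<H> :: "(complex^'n) set set" and \<kappa> :: "(complex^'n) set \<Rightarrow> complex"
  assumes fin: "finite \<H>" and hyp: "\<And>H. H \<in> \<H> \<Longrightarrow> is_hyperplane H"
begin

text \<open>The form \<open>\<Omega>\<close> is closed, since the derivative of \<open>\<phi>(v) / \<phi>(z)\<close> in a direction \<open>d\<close> is
\<open>- \<phi>(v) \<phi>(d) / \<phi>(z)\<^sup>2\<close>, which is symmetric in \<open>v\<close> and \<open>d\<close>. So the curvature is the commutator of the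
values of \<open>\<Omega>\<close>; constant fields show that these have to commute.\<close>
lemma flat_connection_Omega_iff:
  "flat_connection_on (arr_complement \<H>) (Omega h \<H> \<kappa>) \<longleftrightarrow>
    (\<forall>z\<in>arr_complement \<H>. \<forall>u v w.
      Omega h \<H> \<kappa> z u (Omega h \<H> \<kappa> z v w) = Omega h \<H> \<kappa> z v (Omega h \<H> \<kappa> z u w))"
proof -
  have "\<forall>H\<in>\<H>. \<exists>\<phi>. linear_equation H \<phi>" using hyp by (simp add: is_hyperplane_def)
  then obtain \<phi> where eqn: "\<And>H. H \<in> \<H> \<Longrightarrow> linear_equation H (\<phi> H)" by metis
  then have lin\<phi>: "Vector_Spaces.linear (*s) (*) (\<phi> H)" if "H \<in> \<H>" for H
    using that by (simp add: linear_equation_def)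
  have nz: "\<phi> H z \<noteq> 0" if "H \<in> \<H>" "z \<in> arr_complement \<H>" for H z
    using eqn that by (auto simp: linear_equation_def arr_complement_def)
  have Omega: "Omega h \<H> \<kappa> z v w = (\<Sum>H\<in>\<H>. (\<phi> H v / \<phi> H z * \<kappa> H) *s orth_proj h H w)" for z v w
    unfolding Omega_def by (rule sum.cong) (simp_all add: omega_eq[OF eqn])
  define D where "D z d v w =
    (\<Sum>H\<in>\<H>. (- (\<phi> H v * \<phi> H d) / (\<phi> H z * \<phi> H z) * \<kappa> H) *s orth_proj h H w)" for z d v w
  have curv: "curvature (Omega h \<H> \<kappa>) X Y Z z =
      Omega h \<H> \<kappa> z (X z) (Omega h \<H> \<kappa> z (Y z) (Z z)) - Omega h \<H> \<kappa> z (Y z) (Omega h \<H> \<kappa> z (X z) (Z z))"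
    if z: "z \<in> arr_complement \<H>" and "twice_differentiable_on X (arr_complement \<H>)"
      "twice_differentiable_on Y (arr_complement \<H>)" "twice_differentiable_on Z (arr_complement \<H>)" for X Y Z z
  proof (rule curvature_eq_commutator[where D="D z" and U="arr_complement \<H>"])
    show "((\<lambda>x. Omega h \<H> \<kappa> x (Y x) (Z x)) has_derivative
        (\<lambda>d. D z d (Y z) (Z z) + Omega h \<H> \<kappa> z (Y' d) (Z z) + Omega h \<H> \<kappa> z (Y z) (Z' d))) (at z)"
      if YZ: "(Y has_derivative Y') (at z)" "(Z has_derivative Z') (at z)" for Y Z Y' Z'
      unfolding Omega D_def sum.distrib[symmetric]
      by (intro has_derivative_sum has_derivative_log_term lin\<phi> nz z linear_orth_proj hyp YZ)
    show "D z d v w = D z v d w" for d v w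
      unfolding D_def by (simp add: mult.commute)
    show "linear (\<lambda>v. Omega h \<H> \<kappa> z v w)" for w
    proof (rule linearI)
      fix a b and r :: real
      show "Omega h \<H> \<kappa> z (a + b) w = Omega h \<H> \<kappa> z a w + Omega h \<H> \<kappa> z b w"
        unfolding Omega sum.distrib[symmetric]
      proof (rule sum.cong[OF refl])
        fix H assume "H \<in> \<H>"
        interpret Vector_Spaces.linear "(*s)" "(*)" "\<phi> H" by (rule lin\<phi>) fact
        show "(\<phi> H (a + b) / \<phi> H z * \<kappa> H) *s orth_proj h H w =
          (\<phi> H a / \<phi> H z * \<kappa> H) *s orth_proj h H w + (\<phi> H b / \<phi> H z * \<kappa> H) *s orth_proj h H w"
          by (simp add: add add_divide_distrib vec_eq_iff algebra_simps)
      qed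
      show "Omega h \<H> \<kappa> z (r *\<^sub>R a) w = r *\<^sub>R Omega h \<H> \<kappa> z a w"
        unfolding Omega scaleR_sum_right
      proof (rule sum.cong[OF refl])
        fix H assume "H \<in> \<H>"
        interpret Vector_Spaces.linear "(*s)" "(*)" "\<phi> H" by (rule lin\<phi>) fact
        show "(\<phi> H (r *\<^sub>R a) / \<phi> H z * \<kappa> H) *s orth_proj h H w =
          r *\<^sub>R ((\<phi> H a / \<phi> H z * \<kappa> H) *s orth_proj h H w)"
          by (simp add: scale scaleR_eq_vector_scalar_mult)
      qed
    qed
    show "linear (Omega h \<H> \<kappa> z v)" for v
    proof (rule linearI)
      fix a b and r :: real
      show "Omega h \<H> \<kappa> z v (a + b) = Omega h \<H> \<kappa> z v a + Omega h \<H> \<kappa> z v b"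
        unfolding Omega sum.distrib[symmetric]
      proof (rule sum.cong[OF refl])
        fix H assume "H \<in> \<H>"
        then interpret Vector_Spaces.linear "(*s)" "(*s)" "orth_proj h H" by (intro linear_orth_proj hyp)
        show "(\<phi> H v / \<phi> H z * \<kappa> H) *s orth_proj h H (a + b) =
          (\<phi> H v / \<phi> H z * \<kappa> H) *s orth_proj h H a + (\<phi> H v / \<phi> H z * \<kappa> H) *s orth_proj h H b"
          by (simp add: add vec_eq_iff algebra_simps)
      qed
      show "Omega h \<H> \<kappa> z v (r *\<^sub>R a) = r *\<^sub>R Omega h \<H> \<kappa> z v a"
        unfolding Omega scaleR_sum_right
      proof (rule sum.cong[OF refl])
        fix H assume "H \<in> \<H>"
        then interpret Vector_Spaces.linear "(*s)" "(*s)" "orth_proj h H" by (intro linear_orth_proj hyp)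
        show "(\<phi> H v / \<phi> H z * \<kappa> H) *s orth_proj h H (r *\<^sub>R a) =
          r *\<^sub>R ((\<phi> H v / \<phi> H z * \<kappa> H) *s orth_proj h H a)"
          by (simp add: scale scaleR_eq_vector_scalar_mult mult.commute)
      qed
    qed
  qed (use that open_arr_complement[OF fin hyp] in auto)
  show ?thesis
  proof
    assume flat: "flat_connection_on (arr_complement \<H>) (Omega h \<H> \<kappa>)"
    have const: "twice_differentiable_on (\<lambda>_. c) (arr_complement \<H>)" for c
    proof -
      have "blinfun_apply (0 :: (complex^'n) \<Rightarrow>\<^sub>L (complex^'n)) = (\<lambda>_. 0)" by (simp add: fun_eq_iff)
      then show ?thesis
        unfolding twice_differentiable_on_def by (intro exI[of _ "\<lambda>_. 0"]) auto
    qed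
    show "\<forall>z\<in>arr_complement \<H>. \<forall>u v w.
      Omega h \<H> \<kappa> z u (Omega h \<H> \<kappa> z v w) = Omega h \<H> \<kappa> z v (Omega h \<H> \<kappa> z u w)"
    proof (intro ballI allI)
      fix z u v w assume z: "z \<in> arr_complement \<H>"
      have "curvature (Omega h \<H> \<kappa>) (\<lambda>_. u) (\<lambda>_. v) (\<lambda>_. w) z = 0"
        using flat const z unfolding flat_connection_on_def by blast
      then show "Omega h \<H> \<kappa> z u (Omega h \<H> \<kappa> z v w) = Omega h \<H> \<kappa> z v (Omega h \<H> \<kappa> z u w)"
        using curv[OF z const const const, of u v w] by simp
    qed
  next
    assume "\<forall>z\<in>arr_complement \<H>. \<forall>u v w.
      Omega h \<H> \<kappa> z u (Omega h \<H> \<kappa> z v w) = Omega h \<H> \<kappa> z v (Omega h \<H> \<kappa> z u w)"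
    then show "flat_connection_on (arr_complement \<H>) (Omega h \<H> \<kappa>)"
      unfolding flat_connection_on_def by (simp add: curv)
  qed
qed

text \<open>This is the residue of the flatness equations at the codimension two intersection \<open>L\<close> of \<open>H\<close> with the
other hyperplanes through \<open>z\<^sub>0\<close>, in the form in which the classification uses it. Let \<open>z(t)\<close> leave \<open>z\<^sub>0\<close>
inside \<open>H\<close> at speed \<open>t\<close>, in a direction \<open>v\<close> transversal to the other hyperplanes, and leave \<open>H\<close> at
speed \<open>t\<^sup>2\<close> only. At \<open>z(t)\<close> the operator \<open>t\<^sup>2 \<Omega>(u)\<close> sees the pole along \<open>H\<close> alone and tends to
\<open>\<kappa>\<^sub>H \<pi>\<^sub>H\<close>, while \<open>t \<Omega>(v)\<close> has no term from \<open>H\<close> and tends to the sum over the other hyperplanes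
through \<open>z\<^sub>0\<close>. The operators commute for small \<open>t\<close>, hence so do their limits.\<close>
lemma residue_commutes:
  assumes flat: "flat_connection_on (arr_complement \<H>) (Omega h \<H> \<kappa>)"
    and H: "H \<in> \<H>" "\<kappa> H \<noteq> 0" and z\<^sub>0: "z\<^sub>0 \<in> H" and v: "v \<in> H"
    and generic: "\<And>K. K \<in> \<H> \<Longrightarrow> K \<noteq> H \<Longrightarrow> z\<^sub>0 \<in> K \<Longrightarrow> v \<notin> K"
  shows "orth_proj h H (\<Sum>K\<in>{K\<in>\<H>. K \<noteq> H \<and> z\<^sub>0 \<in> K}. \<kappa> K *s orth_proj h K w)
    = (\<Sum>K\<in>{K\<in>\<H>. K \<noteq> H \<and> z\<^sub>0 \<in> K}. \<kappa> K *s orth_proj h K (orth_proj h H w))"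
proof -
  have "\<forall>H\<in>\<H>. \<exists>\<phi>. linear_equation H \<phi>" using hyp by (simp add: is_hyperplane_def)
  then obtain \<phi> where eqn: "\<And>H. H \<in> \<H> \<Longrightarrow> linear_equation H (\<phi> H)" by metis
  then have lin\<phi>: "Vector_Spaces.linear (*s) (*) (\<phi> K)" if "K \<in> \<H>" for K
    using that by (simp add: linear_equation_def)
  have mem: "x \<in> K \<longleftrightarrow> \<phi> K x = 0" if "K \<in> \<H>" for K x
    using eqn[OF that] by (auto simp: linear_equation_def)
  have Omega: "Omega h \<H> \<kappa> z v w = (\<Sum>H\<in>\<H>. (\<phi> H v / \<phi> H z * \<kappa> H) *s orth_proj h H w)" for z v w
    unfolding Omega_def by (rule sum.cong) (simp_all add: omega_eq[OF eqn])
  have lincomb: "\<phi> K (a *s x) = a * \<phi> K x" "\<phi> K (x + y) = \<phi> K x + \<phi> K y" if "K \<in> \<H>" for K a x y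
    using lin\<phi>[OF that] by (simp_all add: Vector_Spaces.linear_iff)
  obtain u where u: "\<phi> H u \<noteq> 0" using eqn[OF H(1)] by (auto simp: linear_equation_def)
  define z where "z t = z\<^sub>0 + t *s v + (t * t) *s u" for t
  have \<phi>z: "\<phi> K (z t) = \<phi> K z\<^sub>0 + t * \<phi> K v + t * t * \<phi> K u" if "K \<in> \<H>" for K t
    using lincomb[OF that] by (simp add: z_def)
  define S where "S = {K\<in>\<H>. K \<noteq> H \<and> z\<^sub>0 \<in> K}"
  have ev: "\<forall>\<^sub>F t in at (0::complex). t \<noteq> 0"
    by (simp add: eventually_at_filter)
  have lim1: "((\<lambda>t. \<phi> K ((t * t) *s u) / \<phi> K (z t)) \<longlongrightarrow> (if K = H then 1 else 0)) (at 0)"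
    and lim2: "((\<lambda>t. \<phi> K (t *s v) / \<phi> K (z t)) \<longlongrightarrow> (if K \<in> S then 1 else 0)) (at 0)"
    and nz: "\<forall>\<^sub>F t in at 0. \<phi> K (z t) \<noteq> 0"
    if K: "K \<in> \<H>" for K
  proof -
    \<comment> \<open>Along the curve \<open>\<phi> K\<close> vanishes to order two, zero and one, respectively.\<close>
    consider "K = H" | "K \<noteq> H" "\<phi> K z\<^sub>0 \<noteq> 0" | "K \<noteq> H" "\<phi> K z\<^sub>0 = 0" "\<phi> K v \<noteq> 0"
      using generic[OF K] mem[OF K] by blast
    then have "((\<lambda>t. \<phi> K ((t * t) *s u) / \<phi> K (z t)) \<longlongrightarrow> (if K = H then 1 else 0)) (at 0) \<and>
      ((\<lambda>t. \<phi> K (t *s v) / \<phi> K (z t)) \<longlongrightarrow> (if K \<in> S then 1 else 0)) (at 0) \<and>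
      (\<forall>\<^sub>F t in at 0. \<phi> K (z t) \<noteq> 0)"
    proof cases
      case 1
      then have 0: "\<phi> K z\<^sub>0 = 0" "\<phi> K v = 0" using z\<^sub>0 v mem[OF K] by auto
      have "((\<lambda>t. \<phi> K ((t * t) *s u) / \<phi> K (z t)) \<longlongrightarrow> 1) (at 0)"
        by (rule tendsto_eventually, use ev in eventually_elim)
          (use 0 u 1 \<phi>z[OF K] lincomb[OF K] in simp)
      moreover have "((\<lambda>t. \<phi> K (t *s v) / \<phi> K (z t)) \<longlongrightarrow> 0) (at 0)"
        using 0 by (simp add: lincomb[OF K])
      moreover have "\<forall>\<^sub>F t in at 0. \<phi> K (z t) \<noteq> 0"
        using ev by eventually_elim (use 0 u 1 \<phi>z[OF K] in simp)
      ultimately show ?thesis using 1 by (simp add: S_def)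
    next
      case 2
      have l: "((\<lambda>t. \<phi> K z\<^sub>0 + t * \<phi> K v + t * t * \<phi> K u) \<longlongrightarrow> \<phi> K z\<^sub>0 + 0 * \<phi> K v + 0 * 0 * \<phi> K u) (at 0)"
        by (intro tendsto_intros)
      then have l: "((\<lambda>t. \<phi> K (z t)) \<longlongrightarrow> \<phi> K z\<^sub>0) (at 0)"
        by (simp add: \<phi>z[OF K])
      then have "\<forall>\<^sub>F t in at 0. \<phi> K (z t) \<noteq> 0"
        using 2(2) by (rule tendsto_imp_eventually_ne)
      moreover have "((\<lambda>t. t * t * \<phi> K u / \<phi> K (z t)) \<longlongrightarrow> 0 * 0 * \<phi> K u / \<phi> K z\<^sub>0) (at 0)"
        "((\<lambda>t. t * \<phi> K v / \<phi> K (z t)) \<longlongrightarrow> 0 * \<phi> K v / \<phi> K z\<^sub>0) (at 0)"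
        by (intro tendsto_intros l 2(2))+
      ultimately show ?thesis using 2 mem[OF K] by (simp add: S_def lincomb[OF K])
    next
      case 3
      have l: "((\<lambda>t. \<phi> K v + t * \<phi> K u) \<longlongrightarrow> \<phi> K v) (at 0)"
        by (auto intro!: tendsto_eq_intros)
      then have ne: "\<forall>\<^sub>F t in at 0. \<phi> K v + t * \<phi> K u \<noteq> 0"
        using 3(3) by (rule tendsto_imp_eventually_ne)
      have fac: "\<phi> K (z t) = t * (\<phi> K v + t * \<phi> K u)" for t
        by (simp add: \<phi>z[OF K] 3(2) algebra_simps)
      have "((\<lambda>t. t * \<phi> K u / (\<phi> K v + t * \<phi> K u)) \<longlongrightarrow> 0 * \<phi> K u / \<phi> K v) (at 0)"
        by (intro tendsto_intros l 3(3))
      moreover have "\<forall>\<^sub>F t in at 0. t * \<phi> K u / (\<phi> K v + t * \<phi> K u) = \<phi> K ((t * t) *s u) / \<phi> K (z t)"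
        using ev by eventually_elim (simp add: fac lincomb[OF K])
      ultimately have lu: "((\<lambda>t. \<phi> K ((t * t) *s u) / \<phi> K (z t)) \<longlongrightarrow> 0 * \<phi> K u / \<phi> K v) (at 0)"
        by (rule Lim_transform_eventually)
      have "((\<lambda>t. \<phi> K v / (\<phi> K v + t * \<phi> K u)) \<longlongrightarrow> \<phi> K v / \<phi> K v) (at 0)"
        by (intro tendsto_intros l 3(3))
      moreover have "\<forall>\<^sub>F t in at 0. \<phi> K v / (\<phi> K v + t * \<phi> K u) = \<phi> K (t *s v) / \<phi> K (z t)"
        using ev by eventually_elim (simp add: fac lincomb[OF K])
      ultimately have lv: "((\<lambda>t. \<phi> K (t *s v) / \<phi> K (z t)) \<longlongrightarrow> \<phi> K v / \<phi> K v) (at 0)"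
        by (rule Lim_transform_eventually)
      have "\<forall>\<^sub>F t in at 0. \<phi> K (z t) \<noteq> 0"
        using ev ne by eventually_elim (simp add: fac)
      then show ?thesis using lu lv 3 mem[OF K] K by (simp add: S_def)
    qed
    then show "((\<lambda>t. \<phi> K ((t * t) *s u) / \<phi> K (z t)) \<longlongrightarrow> (if K = H then 1 else 0)) (at 0)"
      "((\<lambda>t. \<phi> K (t *s v) / \<phi> K (z t)) \<longlongrightarrow> (if K \<in> S then 1 else 0)) (at 0)"
      "\<forall>\<^sub>F t in at 0. \<phi> K (z t) \<noteq> 0"
      by blast+
  qed
  have lim: "((\<lambda>t. Omega h \<H> \<kappa> (z t) (x t) (g t)) \<longlongrightarrow> (\<Sum>K\<in>\<H>. (c K * \<kappa> K) *s orth_proj h K g0)) (at 0)"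
    if "\<And>K. K \<in> \<H> \<Longrightarrow> ((\<lambda>t. \<phi> K (x t) / \<phi> K (z t)) \<longlongrightarrow> c K) (at 0)" "(g \<longlongrightarrow> g0) (at 0)"
    for x g c g0
    unfolding Omega
    by (intro tendsto_sum tendsto_vector_scalar_mult tendsto_mult tendsto_const that
        bounded_linear.tendsto[OF bounded_linear_endomorphism[OF linear_orth_proj[OF hyp]]])
  define PH where "PH w = \<kappa> H *s orth_proj h H w" for w
  define PS where "PS w = (\<Sum>K\<in>S. \<kappa> K *s orth_proj h K w)" for w
  have "(\<Sum>K\<in>\<H>. ((if K = H then 1 else 0) * \<kappa> K) *s orth_proj h K w) = PH w" for w
  proof -
    have "(\<Sum>K\<in>\<H>. ((if K = H then 1 else 0) * \<kappa> K) *s orth_proj h K w)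
      = (\<Sum>K\<in>\<H>. if K = H then PH w else 0)"
      by (rule sum.cong) (auto simp: PH_def)
    then show ?thesis using fin H by simp
  qed
  then have limH: "((\<lambda>t. Omega h \<H> \<kappa> (z t) ((t * t) *s u) (g t)) \<longlongrightarrow> PH g0) (at 0)"
    if "(g \<longlongrightarrow> g0) (at 0)" for g g0
    using lim[OF lim1 that] by simp
  have "(\<Sum>K\<in>\<H>. ((if K \<in> S then 1 else 0) * \<kappa> K) *s orth_proj h K w) = PS w" for w
  proof -
    have "(\<Sum>K\<in>\<H>. ((if K \<in> S then 1 else 0) * \<kappa> K) *s orth_proj h K w)
      = (\<Sum>K\<in>\<H>. if K \<in> S then \<kappa> K *s orth_proj h K w else 0)"
      by (rule sum.cong) auto
    also have "\<dots> = (\<Sum>K\<in>\<H> \<inter> S. \<kappa> K *s orth_proj h K w)"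
      using fin by (simp add: sum.inter_restrict)
    also have "\<H> \<inter> S = S" by (auto simp: S_def)
    finally show ?thesis by (simp add: PS_def)
  qed
  then have limS: "((\<lambda>t. Omega h \<H> \<kappa> (z t) (t *s v) (g t)) \<longlongrightarrow> PS g0) (at 0)"
    if "(g \<longlongrightarrow> g0) (at 0)" for g g0
    using lim[OF lim2 that] by simp
  have "((\<lambda>t. Omega h \<H> \<kappa> (z t) ((t * t) *s u) (Omega h \<H> \<kappa> (z t) (t *s v) w)) \<longlongrightarrow> PH (PS w)) (at 0)"
    by (intro limH limS tendsto_const)
  moreover have "((\<lambda>t. Omega h \<H> \<kappa> (z t) (t *s v) (Omega h \<H> \<kappa> (z t) ((t * t) *s u) w)) \<longlongrightarrow> PS (PH w)) (at 0)"
    by (intro limH limS tendsto_const)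
  moreover have "\<forall>\<^sub>F t in at 0. \<forall>K\<in>\<H>. \<phi> K (z t) \<noteq> 0"
    using nz by (intro eventually_ball_finite fin) blast
  then have "\<forall>\<^sub>F t in at 0. Omega h \<H> \<kappa> (z t) ((t * t) *s u) (Omega h \<H> \<kappa> (z t) (t *s v) w)
      = Omega h \<H> \<kappa> (z t) (t *s v) (Omega h \<H> \<kappa> (z t) ((t * t) *s u) w)"
  proof eventually_elim
    case (elim t)
    then have "z t \<in> arr_complement \<H>" using mem by (auto simp: arr_complement_def)
    then show ?case using flat flat_connection_Omega_iff by blast
  qed
  ultimately have "PH (PS w) = PS (PH w)"
    by (intro tendsto_unique[OF at_neq_bot Lim_transform_eventually])
  moreover have "PS (PH w) = \<kappa> H *s PS (orth_proj h H w)"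
  proof -
    have "orth_proj h K (\<kappa> H *s x) = \<kappa> H *s orth_proj h K x" if "K \<in> S" for K x
      using that linear_orth_proj[OF hyp] by (auto simp: S_def Vector_Spaces.linear_iff)
    then show ?thesis
      unfolding PS_def PH_def vec_eq_iff
      by (simp add: sum_distrib_left mult.left_commute)
  qed
  ultimately have "\<kappa> H *s orth_proj h H (PS w) = \<kappa> H *s PS (orth_proj h H w)"
    by (simp add: PH_def)
  then have "orth_proj h H (PS w) = PS (orth_proj h H w)"
    using H(2) by (simp add: vec_eq_iff)
  then show ?thesis by (simp add: PS_def S_def)
qed

end

end

section \<open>The hyperplanes of type B\<close>

text \<open>The two families of mirrors of the long roots share all arguments, with \<open>s\<close> equal to 1 or -1; hence
the common notation.\<close>
definition H_pair :: "complex \<Rightarrow> 'n \<Rightarrow> 'n \<Rightarrow> (complex^'n) set" where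
  "H_pair s i j = {z. z $ i + s * z $ j = 0}"

lemma H_plus_eq_H_pair: "H_plus i j = H_pair 1 i j"
  by (simp add: H_plus_def H_pair_def)

lemma H_minus_eq_H_pair: "H_minus i j = H_pair (-1) i j"
  by (simp add: H_minus_def H_pair_def)

lemma H_pair_commute:
  assumes "s \<in> {1, -1}"
  shows "H_pair s i j = H_pair s j i"
  using assms by (auto simp: H_pair_def add.commute)

lemma B_arrangement_eq:
  "B_arrangement = range H_coord \<union> {H_pair s i j | s i j. s \<in> {1, -1} \<and> i \<noteq> j}"
  unfolding B_arrangement_def H_plus_eq_H_pair H_minus_eq_H_pair by auto

lemma B_arrangement_cases:
  assumes "H \<in> B_arrangement"
  obtains (coord) i where "H = H_coord i" | (pair) s i j where "H = H_pair s i j" "s \<in> {1, -1}" "i \<noteq> j"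
  using assms unfolding B_arrangement_eq by auto

lemma H_coord_in_B: "H_coord i \<in> B_arrangement"
  by (simp add: B_arrangement_eq)

lemma H_pair_in_B: "s \<in> {1, -1} \<Longrightarrow> i \<noteq> j \<Longrightarrow> H_pair s i j \<in> B_arrangement"
  unfolding B_arrangement_eq by auto

lemma finite_B_arrangement: "finite (B_arrangement :: (complex^'n::finite) set set)"
proof -
  have "{H_pair s i j | s i j. s \<in> {1, -1} \<and> i \<noteq> (j :: 'n)} \<subseteq> (\<lambda>(s, i, j). H_pair s i j) ` ({1, -1} \<times> UNIV \<times> UNIV)"
    by auto
  then have "finite {H_pair s i j | s i j. s \<in> {1, -1} \<and> i \<noteq> (j :: 'n)}"
    by (rule finite_subset) simp
  then show ?thesis by (simp add: B_arrangement_eq)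
qed

lemma linear_equation_H_coord: "linear_equation (H_coord i) (\<lambda>z :: complex^'n::finite. z $ i)"
proof -
  have "Vector_Spaces.linear (*s) (*) (\<lambda>z :: complex^'n. z $ i)"
    by unfold_locales (simp_all add: algebra_simps)
  moreover have "(axis i 1 :: complex^'n) $ i \<noteq> 0" by simp
  ultimately show ?thesis unfolding linear_equation_def H_coord_def by blast
qed

lemma linear_equation_H_pair:
  assumes "i \<noteq> j"
  shows "linear_equation (H_pair s i j) (\<lambda>z :: complex^'n::finite. z $ i + s * z $ j)"
proof -
  have "Vector_Spaces.linear (*s) (*) (\<lambda>z :: complex^'n. z $ i + s * z $ j)"
    by unfold_locales (simp_all add: algebra_simps)
  moreover have "(axis i 1 :: complex^'n) $ i + s * axis i 1 $ j \<noteq> 0" using assms by (simp add: axis_def)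
  ultimately show ?thesis unfolding linear_equation_def H_pair_def by blast
qed

lemma is_hyperplane_B:
  assumes "H \<in> (B_arrangement :: (complex^'n::finite) set set)"
  shows "is_hyperplane H"
  using assms linear_equation_H_coord linear_equation_H_pair
  unfolding B_arrangement_eq is_hyperplane_def by blast

lemma arr_complement_B:
  assumes "z \<in> arr_complement B_arrangement"
  shows "z $ i \<noteq> 0" and "i \<noteq> j \<Longrightarrow> z $ i + z $ j \<noteq> 0" and "i \<noteq> j \<Longrightarrow> z $ i - z $ j \<noteq> 0"
    and "i \<noteq> j \<Longrightarrow> (z $ i)\<^sup>2 - (z $ j)\<^sup>2 \<noteq> 0"
proof -
  have nin: "z \<notin> H" if "H \<in> B_arrangement" for H using assms that by (auto simp: arr_complement_def)
  show "z $ i \<noteq> 0" using nin[OF H_coord_in_B[of i]] by (simp add: H_coord_def)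
  assume ij: "i \<noteq> j"
  show p: "z $ i + z $ j \<noteq> 0" using nin[OF H_pair_in_B[OF _ ij, of 1]] by (simp add: H_pair_def)
  show m: "z $ i - z $ j \<noteq> 0" using nin[OF H_pair_in_B[OF _ ij, of "-1"]] by (simp add: H_pair_def)
  show "(z $ i)\<^sup>2 - (z $ j)\<^sup>2 \<noteq> 0"
    using p m by (simp add: power2_eq_square square_diff_square_factored)
qed

text \<open>Basis vectors distinguish hyperplanes by the coordinates that occur in their equations.\<close>
lemma axis_in_H_coord: "axis k 1 \<in> H_coord i \<longleftrightarrow> k \<noteq> i"
  by (auto simp: H_coord_def axis_def)

lemma axis_in_H_pair: "s \<noteq> 0 \<Longrightarrow> i \<noteq> j \<Longrightarrow> axis k 1 \<in> H_pair s i j \<longleftrightarrow> k \<notin> {i, j}"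
  by (auto simp: H_pair_def axis_def)

text \<open>Used for a single coordinate of a vector valued sum: the hyperplanes whose equation does not involve
\<open>z\<^sub>m\<close> do not contribute, and the remaining ones are listed exactly once by taking \<open>m\<close> as first index.\<close>
lemma sum_B_arrangement_index:
  fixes f :: "(complex^'n::finite) set \<Rightarrow> 'b::comm_monoid_add"
  assumes "\<And>H. H \<in> B_arrangement \<Longrightarrow> axis m 1 \<in> H \<Longrightarrow> f H = 0"
  shows "sum f B_arrangement = f (H_coord m) + (\<Sum>j\<in>UNIV - {m}. f (H_pair 1 m j) + f (H_pair (-1) m j))"
proof -
  \<comment> \<open>The vector \<open>e\<^sub>j - s e\<^sub>m\<close> separates the hyperplanes.\<close>
  have inj: "s = t \<and> j = k" if "H_pair s m j = H_pair t m k" "s \<in> {1,-1}" "t \<in> {1,-1}" "j \<noteq> m" "k \<noteq> m" for s t j k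
  proof -
    have "axis j 1 - s *s axis m 1 \<in> H_pair s m j"
      using that(2,4) by (auto simp: H_pair_def axis_def)
    then have "axis j 1 - s *s axis m 1 \<in> H_pair t m k" using that by simp
    then have "(axis j 1 - s *s axis m 1) $ m + t * (axis j 1 - s *s axis m 1) $ k = 0"
      by (simp only: H_pair_def mem_Collect_eq)
    then have "- s + t * (if k = j then 1 else 0) = 0" using that by (simp add: axis_def)
    then show ?thesis using that by (auto split: if_splits)
  qed
  let ?g = "\<lambda>(s, j). H_pair s m j"
  let ?I = "{1, -1} \<times> (UNIV - {m})"
  have inj': "inj_on ?g ?I" using inj by (auto intro!: inj_onI)
  have star: "{H \<in> B_arrangement. axis m 1 \<notin> H} = insert (H_coord m) (?g ` ?I)"
  proof (intro equalityI subsetI)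
    fix H assume H: "H \<in> {H \<in> B_arrangement. axis m 1 \<notin> H}"
    then have "H \<in> B_arrangement" by simp
    then show "H \<in> insert (H_coord m) (?g ` ?I)"
    proof (cases rule: B_arrangement_cases)
      case (coord i)
      then show ?thesis using H by (simp add: axis_in_H_coord)
    next
      case (pair s i j)
      then have "m \<in> {i, j}" using H axis_in_H_pair[of s i j m] by auto
      then have "H \<in> ?g ` ?I" using pair H_pair_commute[of s i j] by force
      then show ?thesis by simp
    qed
  next
    fix H assume "H \<in> insert (H_coord m) (?g ` ?I)"
    then show "H \<in> {H \<in> B_arrangement. axis m 1 \<notin> H}"
      by (auto simp: H_coord_in_B axis_in_H_coord axis_in_H_pair intro!: H_pair_in_B)
  qed
  have "H_coord m \<noteq> H_pair s m j" if "s \<in> {1, -1}" "j \<noteq> m" for s j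
    using axis_in_H_coord[of j m] axis_in_H_pair[of s m j j] that by auto
  then have notin: "H_coord m \<notin> ?g ` ?I" by auto
  have "sum f B_arrangement = sum f {H \<in> B_arrangement. axis m 1 \<notin> H}"
    using assms by (intro sum.mono_neutral_right finite_B_arrangement) auto
  also have "\<dots> = f (H_coord m) + sum f (?g ` ?I)"
    unfolding star using notin by (simp add: finite_cartesian_product)
  also have "sum f (?g ` ?I) = (\<Sum>(s, j)\<in>?I. f (H_pair s m j))"
    using inj' by (simp add: sum.reindex case_prod_unfold o_def)
  also have "\<dots> = (\<Sum>j\<in>UNIV - {m}. f (H_pair 1 m j) + f (H_pair (-1) m j))"
    by (simp add: sum.cartesian_product[symmetric] sum.distrib)
  finally show ?thesis .
qed

text \<open>Distributing each exponent evenly over the one or two coordinates in the equation of its hyperplane,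
the coordinate \<open>m\<close> receives \<open>a + 2 \<mu>\<^sub>m\<close> from \<open>z\<^sub>m = 0\<close> and \<open>\<mu>\<^sub>m + \<mu>\<^sub>j\<close> from the pair of hyperplanes
\<open>z\<^sub>m = \<plusminus>z\<^sub>j\<close>. The sum over all \<open>m\<close> is \<open>n\<close> times the asserted value.\<close>
lemma kappa_0_B:
  assumes "B_exponents \<mu> a \<kappa>"
  shows "kappa_0 (B_arrangement :: (complex^'n::finite) set set) \<kappa> = a + 2 * (\<Sum>i\<in>UNIV. complex_of_real (\<mu> i))"
proof -
  let ?\<mu> = "\<lambda>i. complex_of_real (\<mu> i)"
  define K where "K H = {k :: 'n. axis k (1 :: complex) \<notin> H}" for H
  define f where "f m H = (if m \<in> K H then \<kappa> H / of_nat (card (K H)) else 0)" for m H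
  have Kc: "K (H_coord i) = {i}" for i by (auto simp: K_def axis_in_H_coord)
  have Kp: "K (H_pair s i j) = {i, j}" if "s \<in> {1, -1}" "i \<noteq> j" for s i j
    using that axis_in_H_pair[of s i j] unfolding K_def by auto
  have "\<kappa> H = (\<Sum>m\<in>UNIV. f m H)" if "H \<in> B_arrangement" for H
  proof -
    have "K H \<noteq> {}" using that Kc Kp unfolding B_arrangement_eq by auto
    then have "card (K H) \<noteq> 0" by simp
    moreover have "(\<Sum>m\<in>UNIV. f m H) = (\<Sum>m\<in>K H. \<kappa> H / of_nat (card (K H)))"
      unfolding f_def by (subst sum.inter_restrict[symmetric]) auto
    ultimately show ?thesis by simp
  qed
  then have "sum \<kappa> B_arrangement = (\<Sum>H\<in>B_arrangement. \<Sum>m\<in>UNIV. f m H)" by (rule sum.cong[OF refl])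
  also have "\<dots> = (\<Sum>m\<in>UNIV. \<Sum>H\<in>B_arrangement. f m H)" by (rule sum.swap)
  also have "\<dots> = (\<Sum>m\<in>UNIV. a + 2 * ?\<mu> m + (\<Sum>j\<in>UNIV - {m}. ?\<mu> m + ?\<mu> j))"
  proof (rule sum.cong[OF refl])
    fix m
    have "(\<Sum>H\<in>B_arrangement. f m H) = f m (H_coord m) + (\<Sum>j\<in>UNIV - {m}. f m (H_pair 1 m j) + f m (H_pair (-1) m j))"
      by (rule sum_B_arrangement_index) (simp add: f_def K_def)
    also have "f m (H_coord m) = a + 2 * ?\<mu> m"
      using assms by (simp add: f_def Kc B_exponents_def)
    also have "(\<Sum>j\<in>UNIV - {m}. f m (H_pair 1 m j) + f m (H_pair (-1) m j)) = (\<Sum>j\<in>UNIV - {m}. ?\<mu> m + ?\<mu> j)"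
    proof (rule sum.cong[OF refl])
      fix j assume "j \<in> UNIV - {m}"
      then have "m \<noteq> j" by auto
      then show "f m (H_pair 1 m j) + f m (H_pair (-1) m j) = ?\<mu> m + ?\<mu> j"
        using assms by (simp add: f_def Kp B_exponents_def H_plus_eq_H_pair H_minus_eq_H_pair)
    qed
    finally show "(\<Sum>H\<in>B_arrangement. f m H) = a + 2 * ?\<mu> m + (\<Sum>j\<in>UNIV - {m}. ?\<mu> m + ?\<mu> j)" .
  qed
  also have "\<dots> = (\<Sum>m\<in>UNIV. a + (\<Sum>j\<in>UNIV. ?\<mu> m + ?\<mu> j))"
  proof (rule sum.cong[OF refl])
    fix m :: 'n
    show "a + 2 * ?\<mu> m + (\<Sum>j\<in>UNIV - {m}. ?\<mu> m + ?\<mu> j) = a + (\<Sum>j\<in>UNIV. ?\<mu> m + ?\<mu> j)"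
      by (simp add: sum.remove[of UNIV m "\<lambda>j. ?\<mu> m + ?\<mu> j"])
  qed
  also have "\<dots> = of_nat CARD('n) * (a + 2 * (\<Sum>i\<in>UNIV. ?\<mu> i))"
    by (simp add: sum.distrib sum_distrib_left[symmetric] algebra_simps)
  finally show ?thesis by (simp add: kappa_0_def)
qed

section \<open>The diagonal inner products\<close>

lemma pos_def_hermitian_diag_inner:
  fixes \<mu> :: "'n::finite \<Rightarrow> real"
  assumes "\<And>i. \<mu> i > 0"
  shows "pos_def_hermitian (diag_inner \<mu>)"
  unfolding pos_def_hermitian_def
proof (intro conjI allI impI)
  fix x y z :: "complex^'n" and c :: complex
  show "diag_inner \<mu> (x + y) z = diag_inner \<mu> x z + diag_inner \<mu> y z"
    by (simp add: diag_inner_def algebra_simps sum.distrib)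
  show "diag_inner \<mu> (c *s x) y = c * diag_inner \<mu> x y"
    by (simp add: diag_inner_def sum_distrib_left mult_ac)
  show "diag_inner \<mu> y x = cnj (diag_inner \<mu> x y)"
    by (simp add: diag_inner_def mult_ac)
  assume "x \<noteq> 0"
  have e: "diag_inner \<mu> x x = complex_of_real (\<Sum>i\<in>UNIV. \<mu> i * (cmod (x $ i))\<^sup>2)"
    unfolding diag_inner_def of_real_sum
    by (intro sum.cong refl) (simp add: complex_norm_square mult.assoc del: of_real_power)
  then show "diag_inner \<mu> x x \<in> \<real>" by simp
  obtain k where "x $ k \<noteq> 0" using \<open>x \<noteq> 0\<close> by (auto simp: vec_eq_iff)
  then have "(\<Sum>i\<in>UNIV. \<mu> i * (cmod (x $ i))\<^sup>2) > 0"
    using assms by (intro sum_pos2[of _ k]) (auto simp: less_imp_le)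
  then show "Re (diag_inner \<mu> x x) > 0" by (simp add: e)
qed

lemma diag_inner_axis_right: "diag_inner \<mu> x (axis i c) = complex_of_real (\<mu> i) * x $ i * cnj c"
proof -
  have "diag_inner \<mu> x (axis i c) =
      (\<Sum>k\<in>UNIV. if k = i then complex_of_real (\<mu> i) * x $ i * cnj c else 0)"
    unfolding diag_inner_def by (rule sum.cong) (auto simp: axis_def)
  then show ?thesis by simp
qed

context
  fixes \<mu> :: "'n::finite \<Rightarrow> real"
  assumes \<mu>: "\<And>i. \<mu> i > 0"
begin

lemma hermitian_\<mu>: "pos_def_hermitian (diag_inner \<mu>)"
  using pos_def_hermitian_diag_inner \<mu> by blast

lemma orth_proj_H_coord: "orth_proj (diag_inner \<mu>) (H_coord i) w = axis i (w $ i)"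
proof -
  have "H_coord i = {x. diag_inner \<mu> x (axis i 1) = 0}"
    using \<mu>[of i] by (auto simp: H_coord_def diag_inner_axis_right)
  moreover have "axis i (1 :: complex) \<noteq> 0" by (simp add: axis_eq_0_iff)
  ultimately have "orth_proj (diag_inner \<mu>) (H_coord i) w =
      (diag_inner \<mu> w (axis i 1) / diag_inner \<mu> (axis i 1) (axis i 1)) *s axis i 1"
    using orth_proj_eq[OF hermitian_\<mu>, of "axis i 1" w] by simp
  also have "\<dots> = w $ i *s axis i 1"
    using \<mu>[of i] by (simp add: diag_inner_axis_right)
  finally show ?thesis by (simp add: vec_eq_iff axis_def)
qed

text \<open>The normal \<open>e\<^sub>i / \<mu>\<^sub>i + s e\<^sub>j / \<mu>\<^sub>j\<close> is multiplied by \<open>\<mu>\<^sub>i \<mu>\<^sub>j\<close>; the denominator \<open>\<mu>\<^sub>i + \<mu>\<^sub>j\<close> is the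
exponent that the theorem prescribes, which explains that choice of exponents.\<close>
lemma orth_proj_H_pair:
  assumes s: "s \<in> {1, -1}" and ij: "i \<noteq> j"
  shows "orth_proj (diag_inner \<mu>) (H_pair s i j) w =
    ((w $ i + s * w $ j) / (complex_of_real (\<mu> i) + complex_of_real (\<mu> j))) *s
      (axis i (complex_of_real (\<mu> j)) + axis j (s * complex_of_real (\<mu> i)))"
proof -
  note h = hermitian_\<mu>
  define n where "n = axis i (complex_of_real (\<mu> j)) + axis j (s * complex_of_real (\<mu> i))"
  have [simp]: "cnj s = s" using s by auto
  have inner: "diag_inner \<mu> x n = complex_of_real (\<mu> i) * complex_of_real (\<mu> j) * (x $ i + s * x $ j)" for x
    by (simp add: n_def hermitian_add_right[OF h] diag_inner_axis_right algebra_simps)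
  have pos: "complex_of_real (\<mu> i) \<noteq> 0" "complex_of_real (\<mu> j) \<noteq> 0"
    using \<mu>[of i] \<mu>[of j] by simp_all
  have n: "n $ i = complex_of_real (\<mu> j)" "n $ j = s * complex_of_real (\<mu> i)"
    using ij by (auto simp: n_def axis_def)
  have "n \<noteq> 0" using n pos by auto
  moreover have "H_pair s i j = {x. diag_inner \<mu> x n = 0}"
    using pos by (auto simp: H_pair_def inner)
  moreover have "n $ i + s * n $ j = complex_of_real (\<mu> i) + complex_of_real (\<mu> j)"
    using n s by auto
  ultimately show ?thesis
    using orth_proj_eq[OF h, of n w] pos by (simp add: inner n_def[symmetric])
qed

lemma orth_proj_diag_component_eq_0:
  assumes "H \<in> B_arrangement" "axis m 1 \<in> H"
  shows "orth_proj (diag_inner \<mu>) H w $ m = 0"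
proof -
  show ?thesis using assms(1)
  proof (cases rule: B_arrangement_cases)
    case (coord i)
    then have "m \<noteq> i" using assms(2) axis_in_H_coord[of m i] by simp
    then show ?thesis using coord by (simp add: orth_proj_H_coord axis_def)
  next
    case (pair s i j)
    then have "m \<noteq> i" "m \<noteq> j" using assms(2) axis_in_H_pair[of s i j m] by auto
    then show ?thesis using pair by (simp add: orth_proj_H_pair axis_def)
  qed
qed

section \<open>The prescribed exponents give a Dunkl form\<close>

context
  fixes a :: complex and \<kappa> :: "(complex^'n) set \<Rightarrow> complex"
  assumes \<kappa>: "B_exponents \<mu> a \<kappa>"
begin

definition B_coeff :: "complex^'n \<Rightarrow> 'n \<Rightarrow> 'n \<Rightarrow> complex" where
  "B_coeff z i j = 2 * complex_of_real (\<mu> j) / ((z $ i)\<^sup>2 - (z $ j)\<^sup>2)"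

text \<open>The matrix of \<open>\<Omega>\<close> in the standard basis. The two terms for \<open>z\<^sub>i = z\<^sub>k\<close> and \<open>z\<^sub>i = - z\<^sub>k\<close> are combined
over the common denominator \<open>z\<^sub>i\<^sup>2 - z\<^sub>k\<^sup>2\<close>, which makes the dependence on the signs of the
coordinates visible.\<close>
definition B_matrix :: "complex^'n \<Rightarrow> complex^'n \<Rightarrow> 'n \<Rightarrow> 'n \<Rightarrow> complex" where
  "B_matrix z v i k =
     (if i = k then (a + 2 * complex_of_real (\<mu> i)) * v $ i / z $ i
        + (\<Sum>j\<in>UNIV - {i}. B_coeff z i j * (z $ i * v $ i - z $ j * v $ j))
      else B_coeff z i k * (z $ i * v $ k - z $ k * v $ i))"

lemma Omega_B_matrix:
  assumes z: "z \<in> arr_complement B_arrangement"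
  shows "Omega (diag_inner \<mu>) B_arrangement \<kappa> z v w $ i = (\<Sum>k\<in>UNIV. B_matrix z v i k * w $ k)"
proof -
  let ?h = "diag_inner \<mu>"
  let ?\<mu> = "\<lambda>i. complex_of_real (\<mu> i)"
  let ?t = "\<lambda>H. omega H z v * \<kappa> H * orth_proj ?h H w $ i"
  have pair: "?t (H_pair s i j) = ?\<mu> j * (v $ i + s * v $ j) * (w $ i + s * w $ j) / (z $ i + s * z $ j)"
    if "s \<in> {1, -1}" "j \<noteq> i" for s j
  proof -
    have "\<kappa> (H_pair s i j) = ?\<mu> i + ?\<mu> j"
      using \<kappa> that by (auto simp: B_exponents_def H_plus_eq_H_pair H_minus_eq_H_pair)
    moreover have "orth_proj ?h (H_pair s i j) w $ i = (w $ i + s * w $ j) / (?\<mu> i + ?\<mu> j) * ?\<mu> j"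
      using that orth_proj_H_pair[of s i j w] by (auto simp: axis_def)
    moreover have "?\<mu> i + ?\<mu> j \<noteq> 0"
      using \<mu>[of i] \<mu>[of j] by (metis add_pos_pos of_real_add of_real_eq_0_iff less_irrefl)
    ultimately show ?thesis
      using that by (simp add: omega_eq[OF linear_equation_H_pair])
  qed
  have "Omega ?h B_arrangement \<kappa> z v w $ i = (\<Sum>H\<in>B_arrangement. ?t H)"
    by (simp add: Omega_def)
  also have "\<dots> = ?t (H_coord i) + (\<Sum>j\<in>UNIV - {i}. ?t (H_pair 1 i j) + ?t (H_pair (-1) i j))"
    by (rule sum_B_arrangement_index) (simp add: orth_proj_diag_component_eq_0)
  also have "?t (H_coord i) = (a + 2 * ?\<mu> i) * v $ i / z $ i * w $ i"
    using \<kappa> by (simp add: omega_eq[OF linear_equation_H_coord] orth_proj_H_coord B_exponents_def axis_def)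
  also have "(\<Sum>j\<in>UNIV - {i}. ?t (H_pair 1 i j) + ?t (H_pair (-1) i j)) =
    (\<Sum>j\<in>UNIV - {i}. B_coeff z i j * (z $ i * v $ i - z $ j * v $ j) * w $ i + B_matrix z v i j * w $ j)"
  proof (rule sum.cong[OF refl])
    fix j assume "j \<in> UNIV - {i}"
    then have ij: "i \<noteq> j" by auto
    note nz = arr_complement_B(2,3)[OF z ij] ij
    have "?t (H_pair 1 i j) + ?t (H_pair (-1) i j) =
      ?\<mu> j * (v $ i + v $ j) * (w $ i + w $ j) / (z $ i + z $ j)
      + ?\<mu> j * (v $ i - v $ j) * (w $ i - w $ j) / (z $ i - z $ j)"
      using pair[of 1 j] pair[of "-1" j] ij by simp
    also have "\<dots> = ?\<mu> j * ((v $ i + v $ j) * (w $ i + w $ j) * (z $ i - z $ j)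
       + (v $ i - v $ j) * (w $ i - w $ j) * (z $ i + z $ j)) / ((z $ i + z $ j) * (z $ i - z $ j))"
      using nz by (simp add: divide_simps) (simp add: algebra_simps)
    also have "\<dots> = B_coeff z i j * (z $ i * v $ i - z $ j * v $ j) * w $ i + B_matrix z v i j * w $ j"
      unfolding B_matrix_def B_coeff_def using ij
      by (simp add: power2_eq_square square_diff_square_factored add_divide_distrib[symmetric])
        (simp add: algebra_simps)
    finally show "?t (H_pair 1 i j) + ?t (H_pair (-1) i j) =
      B_coeff z i j * (z $ i * v $ i - z $ j * v $ j) * w $ i + B_matrix z v i j * w $ j" .
  qed
  also have "(a + 2 * ?\<mu> i) * v $ i / z $ i * w $ i +
      (\<Sum>j\<in>UNIV - {i}. B_coeff z i j * (z $ i * v $ i - z $ j * v $ j) * w $ i + B_matrix z v i j * w $ j)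
    = B_matrix z v i i * w $ i + (\<Sum>j\<in>UNIV - {i}. B_matrix z v i j * w $ j)"
    unfolding B_matrix_def[of z v i i] by (simp add: sum.distrib sum_distrib_right distrib_right)
  also have "\<dots> = (\<Sum>k\<in>UNIV. B_matrix z v i k * w $ k)"
    by (simp add: sum.remove[of UNIV i])
  finally show ?thesis .
qed

text \<open>On the diagonal the products agree termwise, because the entries \<open>(i, k)\<close> and \<open>(k, i)\<close> are
proportional as linear forms in \<open>v\<close>. Off the diagonal the difference of the diagonal entries \<open>i\<close> and
\<open>k\<close> splits into a part \<open>b\<close> in the indices \<open>i\<close> and \<open>k\<close> and one term for each further index \<open>j\<close>. The first
part cancels by itself, and this is where the exponents of \<open>z\<^sub>i = 0\<close> and \<open>z\<^sub>k = 0\<close> must differ by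
\<open>2 \<mu>\<^sub>i - 2 \<mu>\<^sub>k\<close>; each term for \<open>j\<close> cancels with the product of the entries \<open>(i, j)\<close> and \<open>(j, k)\<close> by an
identity of rational functions in three variables.\<close>
lemma B_matrix_commute:
  assumes z: "z \<in> arr_complement B_arrangement"
  shows "(\<Sum>j\<in>UNIV. B_matrix z u i j * B_matrix z v j k) = (\<Sum>j\<in>UNIV. B_matrix z v i j * B_matrix z u j k)"
proof (cases "i = k")
  case True
  have "B_matrix z u i j * B_matrix z v j i = B_matrix z v i j * B_matrix z u j i" for j
    by (cases "i = j") (simp_all add: B_matrix_def mult_ac, simp add: algebra_simps)
  then show ?thesis using True by simp
next
  case False
  let ?J = "UNIV - {i, k}"
  let ?\<mu> = "\<lambda>i. complex_of_real (\<mu> i)"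
  define E where "E v j l = B_coeff z j l * (z $ j * v $ l - z $ l * v $ j)" for v j l
  define D where "D v j l = B_coeff z j l * (z $ j * v $ j - z $ l * v $ l)" for v j l
  define C where "C v j = (a + 2 * ?\<mu> j) * v $ j / z $ j" for v j
  define b where "b v = C v i + D v i k - (C v k + D v k i)" for v
  have split: "(\<Sum>j\<in>UNIV. f j) = f i + f k + (\<Sum>j\<in>?J. f j)" for f :: "'n \<Rightarrow> complex"
    using False by (simp add: sum.remove[of UNIV i] sum.remove[of "UNIV - {i}" k] Diff_insert2[symmetric] add.assoc insert_commute)
  have J1: "(\<Sum>j\<in>UNIV - {i}. f j) = f k + (\<Sum>j\<in>?J. f j)" "(\<Sum>j\<in>UNIV - {k}. f j) = f i + (\<Sum>j\<in>?J. f j)"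
    for f :: "'n \<Rightarrow> complex"
    using False sum.remove[of "UNIV - {i}" k f] sum.remove[of "UNIV - {k}" i f]
    by (simp_all add: Diff_insert2[symmetric] insert_commute)
  have expand: "(\<Sum>j\<in>UNIV. B_matrix z u i j * B_matrix z v j k) =
     C v k * E u i k + D v k i * E u i k + (\<Sum>j\<in>?J. D v k j) * E u i k
     + (C u i * E v i k + D u i k * E v i k + (\<Sum>j\<in>?J. D u i j) * E v i k)
     + (\<Sum>j\<in>?J. E u i j * E v j k)" for u v
  proof -
    have "(\<Sum>j\<in>?J. B_matrix z u i j * B_matrix z v j k) = (\<Sum>j\<in>?J. E u i j * E v j k)"
      by (rule sum.cong) (auto simp: B_matrix_def E_def)
    moreover have "B_matrix z u i k = E u i k" "B_matrix z v i k = E v i k"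
      using False by (simp_all add: B_matrix_def E_def)
    moreover have "B_matrix z u i i = C u i + D u i k + (\<Sum>j\<in>?J. D u i j)"
      unfolding B_matrix_def D_def C_def by (simp add: J1)
    moreover have "B_matrix z v k k = C v k + D v k i + (\<Sum>j\<in>?J. D v k j)"
      unfolding B_matrix_def D_def C_def by (simp add: J1)
    ultimately show ?thesis by (simp add: split algebra_simps)
  qed
  have two: "b u * E v i k = b v * E u i k"
  proof -
    note nz = arr_complement_B(1)[OF z, of i] arr_complement_B(1)[OF z, of k]
    define d where "d = (z $ i)\<^sup>2 - (z $ k)\<^sup>2"
    have d: "d \<noteq> 0" using arr_complement_B(4)[OF z False] by (simp add: d_def)
    have d': "(z $ k)\<^sup>2 - (z $ i)\<^sup>2 = - d" by (simp add: d_def)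
    have b: "b v * (z $ i * z $ k * d) = (a + 2 * ?\<mu> i) * v $ i * z $ k * d - (a + 2 * ?\<mu> k) * v $ k * z $ i * d
      + 2 * (?\<mu> k - ?\<mu> i) * (z $ i * v $ i - z $ k * v $ k) * (z $ i * z $ k)" for v
      unfolding b_def C_def D_def B_coeff_def d' d_def[symmetric]
      using nz d by (simp add: divide_simps) (simp add: algebra_simps)
    have "b u * (z $ i * z $ k * d) * (z $ i * v $ k - z $ k * v $ i) =
      b v * (z $ i * z $ k * d) * (z $ i * u $ k - z $ k * u $ i)"
      unfolding b unfolding d_def by algebra
    then have "z $ i * z $ k * d * (b u * (z $ i * v $ k - z $ k * v $ i)) =
      z $ i * z $ k * d * (b v * (z $ i * u $ k - z $ k * u $ i))"
      by (simp add: mult_ac)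
    then show ?thesis unfolding E_def using nz d by (simp add: mult_ac)
  qed
  have three: "(D u i j - D u k j) * E v i k + E u i j * E v j k = (D v i j - D v k j) * E u i k + E v i j * E u j k"
    if j: "j \<in> ?J" for j
  proof -
    define p where "p = (z $ i)\<^sup>2 - (z $ j)\<^sup>2"
    define q where "q = (z $ k)\<^sup>2 - (z $ j)\<^sup>2"
    define r where "r = (z $ i)\<^sup>2 - (z $ k)\<^sup>2"
    have nz: "p \<noteq> 0" "q \<noteq> 0" "r \<noteq> 0"
      using arr_complement_B(4)[OF z] j False by (auto simp: p_def q_def r_def)
    have q': "(z $ j)\<^sup>2 - (z $ k)\<^sup>2 = - q" by (simp add: q_def)
    have clear: "(D u i j - D u k j) * E v i k + E u i j * E v j k = 4 * ?\<mu> j * ?\<mu> k / (p * q * r) *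
      ((q * (z $ i * u $ i - z $ j * u $ j) - p * (z $ k * u $ k - z $ j * u $ j)) * (z $ i * v $ k - z $ k * v $ i)
       - r * (z $ i * u $ j - z $ j * u $ i) * (z $ j * v $ k - z $ k * v $ j))" for u v
      unfolding D_def E_def B_coeff_def q' p_def[symmetric] q_def[symmetric] r_def[symmetric]
      using nz by (simp add: divide_simps) (simp add: algebra_simps)
    have "(q * (z $ i * u $ i - z $ j * u $ j) - p * (z $ k * u $ k - z $ j * u $ j)) * (z $ i * v $ k - z $ k * v $ i)
       - r * (z $ i * u $ j - z $ j * u $ i) * (z $ j * v $ k - z $ k * v $ j)
      = (q * (z $ i * v $ i - z $ j * v $ j) - p * (z $ k * v $ k - z $ j * v $ j)) * (z $ i * u $ k - z $ k * u $ i)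
       - r * (z $ i * v $ j - z $ j * v $ i) * (z $ j * u $ k - z $ k * u $ j)"
      unfolding p_def q_def r_def by algebra
    then show ?thesis unfolding clear by (rule arg_cong)
  qed
  have "(\<Sum>j\<in>?J. (D u i j - D u k j) * E v i k + E u i j * E v j k) = (\<Sum>j\<in>?J. (D v i j - D v k j) * E u i k + E v i j * E u j k)"
    by (rule sum.cong[OF refl three])
  then have "((\<Sum>j\<in>?J. D u i j) - (\<Sum>j\<in>?J. D u k j)) * E v i k + (\<Sum>j\<in>?J. E u i j * E v j k)
    = ((\<Sum>j\<in>?J. D v i j) - (\<Sum>j\<in>?J. D v k j)) * E u i k + (\<Sum>j\<in>?J. E v i j * E u j k)"
    by (simp add: sum.distrib sum_distrib_right[symmetric] sum_subtractf)
  then show ?thesis using two unfolding expand b_def by algebra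
qed

lemma dunkl_form_B: "dunkl_form (diag_inner \<mu>) B_arrangement \<kappa>"
proof -
  let ?A = "Omega (diag_inner \<mu>) B_arrangement \<kappa>"
  note h = hermitian_\<mu>
  have AA: "?A z u (?A z v w) $ i = (\<Sum>k\<in>UNIV. (\<Sum>j\<in>UNIV. B_matrix z u i j * B_matrix z v j k) * w $ k)"
    if "z \<in> arr_complement B_arrangement" for z u v w i
    unfolding Omega_B_matrix[OF that] sum_distrib_left sum_distrib_right
    by (subst sum.swap) (simp add: mult.assoc)
  have "?A z u (?A z v w) = ?A z v (?A z u w)" if "z \<in> arr_complement B_arrangement" for z u v w
    unfolding vec_eq_iff AA[OF that] B_matrix_commute[OF that, of u _ v] by simp
  then show ?thesis
    unfolding dunkl_form_def
    using flat_connection_Omega_iff[OF h finite_B_arrangement, of \<kappa>] h finite_B_arrangement is_hyperplane_B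
    by blast
qed

text \<open>When the signs of some coordinates of \<open>z\<close> and \<open>v\<close> are changed together, the coefficients, which depend
on the squares of the \<open>z\<^sub>i\<close>, are unchanged, and the entry \<open>(i, k)\<close> is multiplied by the signs of \<open>i\<close> and
\<open>k\<close>. So a sign change conjugates the matrix.\<close>
lemma form_invariant_B:
  "form_invariant_on (arr_complement B_arrangement) (sign_change l) (Omega (diag_inner \<mu>) B_arrangement \<kappa>)"
proof -
  let ?U = "arr_complement B_arrangement :: (complex^'n) set"
  define g where "g i = (if i = l then -1 else 1 :: complex)" for i
  have sc: "sign_change l x $ i = g i * x $ i" for x i by (simp add: sign_change_def g_def)
  have gg: "g i * g i = 1" "(g i)\<^sup>2 = 1" for i by (simp_all add: g_def)
  have invol: "sign_change l (sign_change l x) = x" for x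
    by (simp add: vec_eq_iff sc mult.assoc[symmetric] gg)
  have mem: "sign_change l z \<in> ?U" if z: "z \<in> ?U" for z
  proof -
    have "sign_change l z \<notin> H" if "H \<in> B_arrangement" for H
    proof -
      from that show ?thesis
      proof (cases rule: B_arrangement_cases)
        case (coord i)
        then show ?thesis using arr_complement_B(1)[OF z] by (simp add: H_coord_def sign_change_def)
      next
        case (pair s i j)
        define t where "t = s * (g i * g j)"
        have "t \<in> {1, -1}" using pair(2) by (auto simp: t_def g_def)
        then have "z $ i + t * z $ j \<noteq> 0"
          using arr_complement_B(2,3)[OF z pair(3)] by auto
        moreover have "g i * z $ i + s * (g j * z $ j) = g i * (z $ i + t * z $ j)"
          unfolding t_def using gg(1)[of i] by algebra
        moreover have "g i \<noteq> 0" by (simp add: g_def)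
        ultimately show ?thesis by (simp add: pair(1) H_pair_def sc)
      qed
    qed
    then show ?thesis by (auto simp: arr_complement_def)
  qed
  have "sign_change l ` ?U = ?U"
  proof (intro equalityI subsetI)
    fix x assume "x \<in> ?U"
    then show "x \<in> sign_change l ` ?U" using mem invol by (intro image_eqI[of _ _ "sign_change l x"]) auto
  qed (use mem in auto)
  moreover have "Omega (diag_inner \<mu>) B_arrangement \<kappa> (sign_change l z) (sign_change l v) (sign_change l w) =
      sign_change l (Omega (diag_inner \<mu>) B_arrangement \<kappa> z v w)" if z: "z \<in> ?U" for z v w
  proof -
    have sq: "g i * x * (g i * y) = x * y" for i x y using gg(1)[of i] by algebra
    have coeff: "B_coeff (sign_change l z) i j = B_coeff z i j" for i j
      by (simp add: B_coeff_def sc power_mult_distrib gg)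
    have M: "B_matrix (sign_change l z) (sign_change l v) i k = g i * g k * B_matrix z v i k" for i k
    proof (cases "i = k")
      case True
      then show ?thesis by (simp add: B_matrix_def coeff sc sq gg) (simp add: g_def)
    next
      case False
      then show ?thesis by (simp add: B_matrix_def coeff sc algebra_simps)
    qed
    show ?thesis
      unfolding vec_eq_iff Omega_B_matrix[OF mem[OF z]] sc Omega_B_matrix[OF z] M
      by (auto simp: sum_distrib_left g_def intro!: sum.cong)
  qed
  ultimately show ?thesis by (simp add: form_invariant_on_def)
qed

end

end

section \<open>Generic points of intersections of two mirrors\<close>

text \<open>The residues are taken at points whose coordinates are \<open>0\<close> or plus or minus one of the numbers
\<open>R k\<close>, so that a root vanishes there only for an evident reason.\<close>
lemma generic_coordinates:
  obtains R :: "'n::finite \<Rightarrow> complex"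
  where "\<And>k. R k \<noteq> 0" "\<And>k l. R k = R l \<longleftrightarrow> k = l" "\<And>k l. R k + R l \<noteq> 0"
proof -
  obtain r :: "'n \<Rightarrow> nat" where r: "inj r" using finite_imp_inj_to_nat_seg[of "UNIV :: 'n set"] by auto
  define R where "R k = (of_nat (Suc (r k)) :: complex)" for k
  have "R k + R l = of_nat (Suc (r k) + Suc (r l))" for k l by (simp add: R_def)
  then have "R k + R l \<noteq> 0" for k l by (metis add_Suc nat.distinct(1) of_nat_eq_0_iff)
  moreover have "R k \<noteq> 0" for k unfolding R_def by (metis nat.distinct(1) of_nat_eq_0_iff)
  moreover have "R k = R l \<longleftrightarrow> k = l" for k l
    unfolding R_def using r by (simp add: inj_eq)
  ultimately show ?thesis using that by blast
qed

lemma ex_third_index: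
  fixes i j :: "'n::finite"
  assumes "CARD('n) \<ge> 3"
  obtains k where "k \<noteq> i" "k \<noteq> j"
proof -
  have "card {i, j} \<le> 2" by (cases "i = j") auto
  then have "{i, j} \<noteq> UNIV" using assms by auto
  then show ?thesis using that by blast
qed

text \<open>The sign (or zero) \<open>e l\<close> of the coordinate \<open>l\<close> is kept apart from its size \<open>R (c l)\<close>: identifying two
indices by \<open>c\<close> imposes one equation \<open>z\<^sub>i = \<plusminus>z\<^sub>j\<close>.\<close>
definition signed_point :: "('n \<Rightarrow> complex) \<Rightarrow> ('n \<Rightarrow> complex) \<Rightarrow> ('n \<Rightarrow> 'n) \<Rightarrow> complex^'n" where
  "signed_point R e c = (\<chi> l. e l * R (c l))"

context
  fixes R :: "'n::finite \<Rightarrow> complex"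
  assumes R: "\<And>k. R k \<noteq> 0" "\<And>k l. R k = R l \<longleftrightarrow> k = l" "\<And>k l. R k + R l \<noteq> 0"
begin

lemma signed_point_in_H_coord: "signed_point R e c \<in> H_coord a \<longleftrightarrow> e a = 0"
  by (simp add: signed_point_def H_coord_def R)

text \<open>Up to the unit \<open>e a\<close>, the value of the root is \<open>R (c a) + u R (c b)\<close> with \<open>u\<close> one of \<open>0\<close>, \<open>1\<close>, \<open>-1\<close>.\<close>
lemma signed_point_in_H_pair:
  assumes e: "\<And>l. e l \<in> {-1, 0, 1}" and t: "t \<in> {1, -1}"
  shows "signed_point R e c \<in> H_pair t a b \<longleftrightarrow>
    (e a = 0 \<and> e b = 0) \<or> (e a \<noteq> 0 \<and> c a = c b \<and> e a + t * e b = 0)"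
proof -
  \<comment> \<open>As \<open>e a\<close> is its own inverse when nonzero, this is the quotient of the two coefficients.\<close>
  define u where "u = e a * t * e b"
  have eab: "e a \<in> {-1, 0, 1}" "e b \<in> {-1, 0, 1}" using e by blast+
  then have "u \<in> {-1, 0, 1}" using t by (auto simp: u_def)
  then have R_comb: "R k + u * R l = 0 \<longleftrightarrow> u = -1 \<and> k = l" for k l
    using R(1)[of k] R(2)[of k l] R(3)[of k l] by auto
  show ?thesis
  proof (cases "e a = 0")
    case True
    then show ?thesis using t R by (auto simp: signed_point_def H_pair_def)
  next
    case False
    have aa: "e a * e a = 1" using False eab by auto
    have "e a * R (c a) + t * (e b * R (c b)) = e a * (R (c a) + u * R (c b))"
      unfolding u_def using aa by algebra
    then have "signed_point R e c \<in> H_pair t a b \<longleftrightarrow> u = -1 \<and> c a = c b"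
      using False R_comb by (simp add: signed_point_def H_pair_def)
    moreover have "e a * (e a + t * e b) = 1 + u" unfolding u_def using aa by algebra
    then have "u = -1 \<longleftrightarrow> e a + t * e b = 0" using False
      by (metis add_eq_0_iff mult_eq_0_iff)
    ultimately show ?thesis using False by auto
  qed
qed

lemma hyperplanes_through_coord_pair:
  assumes s: "s \<in> {1, -1}" and ijk: "i \<noteq> j" "i \<noteq> k" "j \<noteq> k"
  shows "{K \<in> B_arrangement. K \<noteq> H_coord i \<and>
      signed_point R ((\<lambda>_. 1)(i := 0, j := - s)) (id(j := k)) \<in> K} = {H_pair s j k}" (is "?S = _")
proof -
  let ?e = "(\<lambda>_. 1)(i := 0, j := - s)" and ?c = "id(j := k)"
  have e: "?e l \<in> {-1, 0, 1}" for l using s by auto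
  note in_pair = signed_point_in_H_pair[of ?e, OF e]
  show ?thesis
  proof (intro equalityI subsetI)
    fix K assume K: "K \<in> ?S"
    then have "K \<in> B_arrangement" by simp
    then show "K \<in> {H_pair s j k}"
    proof (cases rule: B_arrangement_cases)
      case (coord a)
      then show ?thesis using K s by (auto simp: signed_point_in_H_coord split: if_splits)
    next
      case (pair t a b)
      then have "signed_point R ?e ?c \<in> H_pair t a b" using K by simp
      then have "(?e a = 0 \<and> ?e b = 0) \<or> (?c a = ?c b \<and> ?e a + t * ?e b = 0)"
        unfolding in_pair[OF pair(2)] by blast
      then have "(a = j \<and> b = k \<or> a = k \<and> b = j) \<and> t = s"
        using pair s ijk by (auto split: if_splits)
      then show ?thesis using pair(1) H_pair_commute[OF s, of j k] by (elim conjE disjE) simp_all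
    qed
  next
    fix K assume "K \<in> {H_pair s j k}"
    moreover have "axis i 1 \<in> H_pair s j k" "axis i 1 \<notin> H_coord i"
      using s ijk axis_in_H_pair[of s j k i] axis_in_H_coord[of i i] by auto
    then have "H_pair s j k \<noteq> H_coord i" by metis
    moreover have "signed_point R ?e ?c \<in> H_pair s j k"
      unfolding in_pair[OF s] using s ijk by auto
    ultimately show "K \<in> ?S" using s ijk by (auto intro!: H_pair_in_B)
  qed
qed

lemma hyperplanes_through_triple:
  assumes st: "s \<in> {1, -1}" "t \<in> {1, -1}" and ijk: "i \<noteq> j" "i \<noteq> k" "j \<noteq> k"
  shows "{K \<in> B_arrangement. K \<noteq> H_pair (- (s * t)) i j \<and>
      signed_point R ((\<lambda>_. 1)(i := - s, j := - t)) (id(i := k, j := k)) \<in> K}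
    = {H_pair s i k, H_pair t j k}" (is "?S = _")
proof -
  let ?e = "(\<lambda>_. 1)(i := - s, j := - t)" and ?c = "id(i := k, j := k)"
  have e: "?e l \<in> {-1, 0, 1}" for l using st by auto
  note in_pair = signed_point_in_H_pair[of ?e, OF e]
  have ne: "?e l \<noteq> 0" for l using st by auto
  have st': "- (s * t) \<in> {1, -1}" using st by auto
  show ?thesis
  proof (intro equalityI subsetI)
    fix K assume K: "K \<in> ?S"
    then have "K \<in> B_arrangement" by simp
    then show "K \<in> {H_pair s i k, H_pair t j k}"
    proof (cases rule: B_arrangement_cases)
      case (coord a)
      then show ?thesis using K ne[of a] by (simp add: signed_point_in_H_coord)
    next
      case (pair r a b)
      then have "signed_point R ?e ?c \<in> H_pair r a b" using K by simp
      then have "?c a = ?c b" "?e a + r * ?e b = 0"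
        unfolding in_pair[OF pair(2)] using ne by blast+
      then have "(a = i \<and> b = k \<or> a = k \<and> b = i) \<and> r = s \<or> (a = j \<and> b = k \<or> a = k \<and> b = j) \<and> r = t
        \<or> (a = i \<and> b = j \<or> a = j \<and> b = i) \<and> r = - (s * t)"
        using pair st ijk by (auto split: if_splits)
      moreover have "K \<noteq> H_pair (- (s * t)) i j" using K by simp
      ultimately show ?thesis
        using pair(1) H_pair_commute[OF st(1), of i k] H_pair_commute[OF st(2), of j k] H_pair_commute[OF st', of i j]
        by (elim conjE disjE) simp_all
    qed
  next
    fix K assume "K \<in> {H_pair s i k, H_pair t j k}"
    moreover have "H_pair s i k \<noteq> H_pair (- (s * t)) i j" "H_pair t j k \<noteq> H_pair (- (s * t)) i j"
      using axis_in_H_pair[of s i k j] axis_in_H_pair[of t j k i] axis_in_H_pair[of "- (s * t)" i j]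
        st st' ijk by auto
    moreover have "signed_point R ?e ?c \<in> H_pair s i k" "signed_point R ?e ?c \<in> H_pair t j k"
      using st ijk by (auto simp: in_pair)
    ultimately show "K \<in> ?S" using st ijk by (auto intro!: H_pair_in_B)
  qed
qed

lemma hyperplanes_through_double_zero:
  assumes ij: "i \<noteq> j"
  shows "{K \<in> B_arrangement. K \<noteq> H_pair 1 i j \<and> signed_point R ((\<lambda>_. 1)(i := 0, j := 0)) id \<in> K}
    = {H_coord i, H_coord j, H_pair (-1) i j}" (is "?S = _")
proof -
  let ?e = "(\<lambda>_. 1)(i := 0, j := 0) :: 'n \<Rightarrow> complex"
  have e: "?e l \<in> {-1, 0, 1}" for l by auto
  note in_pair = signed_point_in_H_pair[of ?e, OF e]
  show ?thesis
  proof (intro equalityI subsetI)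
    fix K assume K: "K \<in> ?S"
    then have "K \<in> B_arrangement" by simp
    then show "K \<in> {H_coord i, H_coord j, H_pair (-1) i j}"
    proof (cases rule: B_arrangement_cases)
      case (coord a)
      then show ?thesis using K by (auto simp: signed_point_in_H_coord split: if_splits)
    next
      case (pair r a b)
      then have "signed_point R ?e id \<in> H_pair r a b" using K by simp
      then have "?e a = 0 \<and> ?e b = 0"
        unfolding in_pair[OF pair(2)] using pair(3) by auto
      then have "a = i \<and> b = j \<or> a = j \<and> b = i" using pair(3) by (auto split: if_splits)
      then have "K = H_pair r i j" using pair(1) H_pair_commute[OF pair(2), of i j] by auto
      moreover have "K \<noteq> H_pair 1 i j" using K by simp
      ultimately show ?thesis using pair(2) by auto
    qed
  next
    fix K assume "K \<in> {H_coord i, H_coord j, H_pair (-1) i j}"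
    moreover have "H_coord i \<noteq> H_pair 1 i j" "H_coord j \<noteq> H_pair 1 i j"
      using axis_in_H_coord[of j i] axis_in_H_coord[of i j] axis_in_H_pair[of 1 i j] ij by auto
    moreover have "H_pair (-1) i j \<noteq> H_pair 1 i j"
    proof -
      have "axis i 1 + axis j 1 \<in> H_pair (-1) i j" "axis i 1 + axis j 1 \<notin> H_pair 1 i j"
        using ij by (auto simp: H_pair_def axis_def)
      then show ?thesis by auto
    qed
    ultimately show "K \<in> ?S" using ij
      by (auto simp: in_pair signed_point_in_H_coord H_coord_in_B intro!: H_pair_in_B)
  qed
qed

end

section \<open>Classification of the Dunkl forms\<close>

text \<open>Applied to \<open>n\<close>, the two products of the projections are a multiple of \<open>n\<close> and a nonzero multiple of \<open>m\<close>.\<close>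
lemma commuting_orth_proj:
  assumes h: "pos_def_hermitian h" and n: "n \<noteq> 0" and m: "m \<noteq> 0"
    and comm: "\<And>w. orth_proj h {x. h x n = 0} (orth_proj h {x. h x m = 0} w)
      = orth_proj h {x. h x m = 0} (orth_proj h {x. h x n = 0} w)"
    and "h n m \<noteq> 0"
  obtains c where "m = c *s n"
proof -
  have ne: "h n n \<noteq> 0" "h m m \<noteq> 0" using n m hermitian_self_eq_0_iff[OF h] by auto
  note P = orth_proj_eq[OF h n] orth_proj_eq[OF h m]
  have "(h n m / h m m) *s m = ((h n m / h m m) * (h m n / h n n)) *s n"
    using comm[of n] ne by (simp add: P hermitian_scale_left[OF h])
  then have "(h m m / h n m) *s ((h n m / h m m) *s m) = (h m m / h n m) *s (((h n m / h m m) * (h m n / h n n)) *s n)"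
    by simp
  then have "m = ((h m m / h n m) * ((h n m / h m m) * (h m n / h n n))) *s n"
    using ne assms(5) by simp
  then show ?thesis by (rule that)
qed

context
  fixes h :: "complex^'n::finite \<Rightarrow> complex^'n \<Rightarrow> complex" and \<kappa> :: "(complex^'n) set \<Rightarrow> complex"
  assumes dunkl: "dunkl_form h B_arrangement \<kappa>"
    and \<kappa>: "\<And>H. H \<in> B_arrangement \<Longrightarrow> \<kappa> H \<noteq> 0"
    and n3: "CARD('n) \<ge> 3"
begin

lemma hermitian_h: "pos_def_hermitian h"
  using dunkl by (simp add: dunkl_form_def)

lemma residue_commutes_B:
  assumes "H \<in> B_arrangement" "z \<in> H" "v \<in> H" "{K \<in> B_arrangement. K \<noteq> H \<and> z \<in> K} = S"
    "\<And>K. K \<in> S \<Longrightarrow> v \<notin> K"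
  shows "orth_proj h H (\<Sum>K\<in>S. \<kappa> K *s orth_proj h K w) = (\<Sum>K\<in>S. \<kappa> K *s orth_proj h K (orth_proj h H w))"
  using residue_commutes[OF hermitian_h finite_B_arrangement is_hyperplane_B, of \<kappa> H z v w] dunkl assms \<kappa>
  unfolding dunkl_form_def by blast

text \<open>For distinct \<open>i\<close>, \<open>j\<close>, \<open>k\<close> only two mirrors contain the intersection of \<open>z\<^sub>i = 0\<close> with \<open>z\<^sub>j = \<plusminus>z\<^sub>k\<close>, so
their projections commute and their normals are orthogonal. If \<open>g i\<close> represents the coordinate \<open>z\<^sub>i\<close>,
then \<open>g i\<close> is orthogonal to \<open>g j + g k\<close> and to \<open>g j - g k\<close>, hence to \<open>g j\<close>. A third index has to
exist for this.\<close>
lemma diagonal_inner_product: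
  obtains \<mu> where "\<And>i. \<mu> i > 0" "h = diag_inner \<mu>"
proof -
  note h = hermitian_h
  have "\<exists>g. \<forall>x. h x g = x $ i" for i
    using riesz_representation[OF h, of "\<lambda>x. x $ i"] linear_equation_H_coord[of i]
    by (metis linear_equation_def)
  then obtain g where g: "\<And>i x. h x (g i) = x $ i" by metis
  have orth: "g i $ j = 0" if ij: "i \<noteq> j" for i j
  proof -
    obtain k where k: "k \<noteq> i" "k \<noteq> j" using ex_third_index[OF n3] by blast
    have "g i $ j + s * g i $ k = 0" if s: "s \<in> {1, -1}" for s
    proof (rule ccontr)
      assume ne: "g i $ j + s * g i $ k \<noteq> 0"
      define m where "m = g j + s *s g k"
      have cs: "cnj s = s" using s by auto
      have hm: "h x m = x $ j + s * x $ k" for x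
        by (simp add: m_def hermitian_add_right[OF h] hermitian_scale_right[OF h] g cs)
      have H_i: "H_coord i = {x. h x (g i) = 0}" and H_jk: "H_pair s j k = {x. h x m = 0}"
        by (auto simp: H_coord_def H_pair_def g hm)
      have "g i \<noteq> 0" using g[of "axis i 1" i] hermitian_scale_right[OF h, of "axis i 1" 0 0] by auto
      have "h (axis j 1) m = 1" using k by (simp add: hm axis_def)
      then have "m \<noteq> 0" using hermitian_scale_right[OF h, of "axis j 1" 0 0] by auto
      obtain R :: "'n \<Rightarrow> complex" where R: "\<And>k. R k \<noteq> 0" "\<And>k l. R k = R l \<longleftrightarrow> k = l" "\<And>k l. R k + R l \<noteq> 0"
        using generic_coordinates by blast
      let ?K = "H_pair s j k"
      have K: "?K \<in> B_arrangement" using s k by (intro H_pair_in_B) auto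
      have "axis j 1 \<in> H_coord i" using ij by (simp add: axis_in_H_coord)
      moreover have "axis j 1 \<notin> ?K" using s k by (auto simp: axis_in_H_pair)
      moreover have "signed_point R ((\<lambda>_. 1)(i := 0, j := - s)) (id(j := k)) \<in> H_coord i"
        using ij by (simp add: signed_point_in_H_coord[OF R])
      moreover have "i \<noteq> k" "j \<noteq> k" using k by auto
      ultimately have res: "orth_proj h (H_coord i) (\<Sum>K\<in>{?K}. \<kappa> K *s orth_proj h K w)
          = (\<Sum>K\<in>{?K}. \<kappa> K *s orth_proj h K (orth_proj h (H_coord i) w))" for w
        using residue_commutes_B[OF H_coord_in_B _ _ hyperplanes_through_coord_pair[OF R s ij]] by blast
      have "orth_proj h (H_coord i) (orth_proj h ?K w) = orth_proj h ?K (orth_proj h (H_coord i) w)" for w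
      proof -
        have "\<kappa> ?K *s orth_proj h (H_coord i) (orth_proj h ?K w) = \<kappa> ?K *s orth_proj h ?K (orth_proj h (H_coord i) w)"
          using res[of w] linear_orth_proj[OF h is_hyperplane_B[OF H_coord_in_B[of i]]]
          by (simp add: Vector_Spaces.linear_iff)
        then show ?thesis using \<kappa>[OF K] by (simp add: vec_eq_iff)
      qed
      then obtain c where "m = c *s g i"
        using commuting_orth_proj[OF h \<open>g i \<noteq> 0\<close> \<open>m \<noteq> 0\<close>] ne unfolding H_i H_jk hm by blast
      then have "h (axis j 1) m = 0" using ij by (simp add: hermitian_scale_right[OF h] g axis_def)
      then show False using \<open>h (axis j 1) m = 1\<close> by simp
    qed
    from this[of 1] this[of "-1"] show ?thesis by simp
  qed
  define \<gamma> where "\<gamma> i = Re (g i $ i)" for i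
  have \<gamma>: "g i = axis i (complex_of_real (\<gamma> i))" "\<gamma> i > 0" for i
  proof -
    have "g i \<noteq> 0" using g[of "axis i 1" i] hermitian_scale_right[OF h, of "axis i 1" 0 0] by auto
    moreover have "\<forall>x. x \<noteq> 0 \<longrightarrow> h x x \<in> \<real> \<and> Re (h x x) > 0"
      using h unfolding pos_def_hermitian_def by (elim conjE)
    ultimately have "g i $ i \<in> \<real>" "Re (g i $ i) > 0" by (metis g)+
    then show "g i = axis i (complex_of_real (\<gamma> i))" "\<gamma> i > 0"
      using orth by (auto simp: vec_eq_iff axis_def \<gamma>_def of_real_Re)
  qed
  define \<mu> where "\<mu> i = 1 / \<gamma> i" for i
  have h_axis: "h x (axis i 1) = complex_of_real (\<mu> i) * x $ i" for x i
  proof -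
    have "axis i 1 = complex_of_real (\<mu> i) *s g i"
      using \<gamma>(2)[of i] by (simp add: \<gamma>(1)[of i] \<mu>_def vec_eq_iff axis_def)
    then show ?thesis by (simp add: hermitian_scale_right[OF h] g)
  qed
  have "h x y = diag_inner \<mu> x y" for x y
  proof -
    have "h y x = (\<Sum>i\<in>UNIV. y $ i * h (axis i 1) x)"
      by (rule linear_functional_expansion[OF linear_hermitian[OF h]])
    also have "\<dots> = (\<Sum>i\<in>UNIV. y $ i * cnj (complex_of_real (\<mu> i) * x $ i))"
      by (simp only: hermitian_cnj[OF h, of "axis _ 1" x] h_axis)
    finally show ?thesis
      using hermitian_cnj[OF h, of x y] by (simp add: diag_inner_def mult_ac)
  qed
  moreover have "\<mu> i > 0" for i using \<gamma>(2)[of i] by (simp add: \<mu>_def)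
  ultimately show ?thesis using that by blast
qed

context
  fixes \<mu> :: "'n \<Rightarrow> real"
  assumes \<mu>: "\<And>i. \<mu> i > 0" and h_eq: "h = diag_inner \<mu>"
begin

text \<open>The exponent of \<open>z\<^sub>i + s z\<^sub>j = 0\<close> relative to the prescribed value \<open>\<mu>\<^sub>i + \<mu>\<^sub>j\<close>; the aim is to show that
it is constant.\<close>
definition ratio :: "complex \<Rightarrow> 'n \<Rightarrow> 'n \<Rightarrow> complex" where
  "ratio s i j = \<kappa> (H_pair s i j) / (complex_of_real (\<mu> i) + complex_of_real (\<mu> j))"

lemma mu_sum_nonzero: "complex_of_real (\<mu> i) + complex_of_real (\<mu> j) \<noteq> 0"
  using \<mu>[of i] \<mu>[of j] by (metis add_pos_pos of_real_add of_real_eq_0_iff less_irrefl)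

lemma kappa_H_pair: "\<kappa> (H_pair s i j) = ratio s i j * (complex_of_real (\<mu> i) + complex_of_real (\<mu> j))"
  using mu_sum_nonzero by (simp add: ratio_def)

lemma ratio_commute: "s \<in> {1, -1} \<Longrightarrow> ratio s i j = ratio s j i"
  using H_pair_commute[of s i j] by (simp add: ratio_def add.commute)

lemma kappa_orth_proj_H_pair:
  assumes "s \<in> {1, -1}" "i \<noteq> j"
  shows "\<kappa> (H_pair s i j) *s orth_proj h (H_pair s i j) w =
    (ratio s i j * (w $ i + s * w $ j)) *s (axis i (complex_of_real (\<mu> j)) + axis j (s * complex_of_real (\<mu> i)))"
  unfolding h_eq orth_proj_H_pair[OF \<mu> assms] kappa_H_pair vector_smult_assoc
  using mu_sum_nonzero[of i j] by simp

text \<open>Three mirrors meet in \<open>z\<^sub>i = - s z\<^sub>k\<close>, \<open>z\<^sub>j = - t z\<^sub>k\<close>. The third one, \<open>z\<^sub>i = s t z\<^sub>j\<close>, has a normal \<open>n\<close>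
without component \<open>k\<close>, and \<open>n\<close> is an eigenvector of the sum of the other two residues. So component
\<open>k\<close> of the image of \<open>n\<close> vanishes, and this component is proportional to the difference of the ratios.\<close>
lemma ratio_triple:
  assumes s: "s \<in> {1, -1}" and t: "t \<in> {1, -1}" and ijk: "i \<noteq> j" "i \<noteq> k" "j \<noteq> k"
  shows "ratio s i k = ratio t j k"
proof -
  let ?\<mu> = "\<lambda>i. complex_of_real (\<mu> i)"
  obtain R :: "'n \<Rightarrow> complex" where R: "\<And>k. R k \<noteq> 0" "\<And>k l. R k = R l \<longleftrightarrow> k = l" "\<And>k l. R k + R l \<noteq> 0"
    using generic_coordinates by blast
  define r where "r = - (s * t)"
  have r: "r \<in> {1, -1}" using s t by (auto simp: r_def)
  let ?H = "H_pair r i j"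
  let ?z = "signed_point R ((\<lambda>_. 1)(i := - s, j := - t)) (id(i := k, j := k))"
  define n where "n = axis i (?\<mu> j) + axis j (r * ?\<mu> i)"
  have n: "n $ i = ?\<mu> j" "n $ j = r * ?\<mu> i" "n $ k = 0" using ijk by (auto simp: n_def axis_def)
  define T where "T w = (\<Sum>K\<in>{H_pair s i k, H_pair t j k}. \<kappa> K *s orth_proj h K w)" for w
  have "?z \<in> ?H" using s t ijk by (auto simp: signed_point_def H_pair_def r_def)
  moreover have "axis k 1 \<in> ?H" using ijk r axis_in_H_pair[of r i j k] by auto
  moreover have "axis k 1 \<notin> K" if "K \<in> {H_pair s i k, H_pair t j k}" for K
    using that ijk s t axis_in_H_pair[of s i k k] axis_in_H_pair[of t j k k] by auto
  ultimately have comm: "orth_proj h ?H (T w) = T (orth_proj h ?H w)" for w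
    unfolding T_def r_def
    using residue_commutes_B[OF H_pair_in_B[OF r ijk(1)] _ _ hyperplanes_through_triple[OF R s t ijk, folded r_def]]
    unfolding r_def by blast
  have P_H: "orth_proj h ?H w = ((w $ i + r * w $ j) / (?\<mu> i + ?\<mu> j)) *s n" for w
    unfolding n_def h_eq by (rule orth_proj_H_pair[OF \<mu> r ijk(1)])
  have "r * r = 1" using r by auto
  then have n_pair: "?\<mu> j + r * (r * ?\<mu> i) = ?\<mu> i + ?\<mu> j"
    by (simp add: mult.assoc[symmetric])
  have "orth_proj h ?H n = n"
    unfolding P_H n n_pair using mu_sum_nonzero[of i j] by simp
  then have "T n = orth_proj h ?H (T n)" using comm by simp
  then have "T n $ k = 0"
    using n(3) P_H by (metis mult_zero_right vector_smult_component)
  moreover have "H_pair s i k \<noteq> H_pair t j k"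
    using axis_in_H_pair[of s i k i] axis_in_H_pair[of t j k i] ijk s t by auto
  then have "T n = \<kappa> (H_pair s i k) *s orth_proj h (H_pair s i k) n + \<kappa> (H_pair t j k) *s orth_proj h (H_pair t j k) n"
    by (simp add: T_def)
  then have "T n $ k = ratio s i k * ?\<mu> j * (s * ?\<mu> i) + ratio t j k * (r * ?\<mu> i) * (t * ?\<mu> j)"
    unfolding kappa_orth_proj_H_pair[OF s ijk(2)] kappa_orth_proj_H_pair[OF t ijk(3)] n
    using ijk by (simp add: axis_def)
  ultimately have "s * ?\<mu> i * ?\<mu> j * (ratio s i k - t * t * ratio t j k) = 0"
    unfolding r_def by algebra
  moreover have "t * t = 1" "s \<noteq> 0" using s t by auto
  ultimately show ?thesis using \<mu>[of i] \<mu>[of j] by auto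
qed

text \<open>The mirrors through \<open>z\<^sub>i = z\<^sub>j = 0\<close> form an arrangement of type \<open>B\<^sub>2\<close>. The normal \<open>n\<close> of \<open>z\<^sub>i + z\<^sub>j = 0\<close> is
an eigenvector of the sum of the other three residues; reading off the eigenvalue from the components
\<open>i\<close> and \<open>j\<close> gives two expressions that have to agree.\<close>
lemma kappa_H_coord_diff:
  assumes ij: "i \<noteq> j"
  shows "\<kappa> (H_coord i) - \<kappa> (H_coord j) =
    2 * ratio (-1) i j * (complex_of_real (\<mu> i) - complex_of_real (\<mu> j))"
proof -
  let ?\<mu> = "\<lambda>i. complex_of_real (\<mu> i)"
  obtain R :: "'n \<Rightarrow> complex" where R: "\<And>k. R k \<noteq> 0" "\<And>k l. R k = R l \<longleftrightarrow> k = l" "\<And>k l. R k + R l \<noteq> 0"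
    using generic_coordinates by blast
  let ?H = "H_pair 1 i j"
  let ?S = "{H_coord i, H_coord j, H_pair (-1) i j}"
  define n where "n = axis i (?\<mu> j) + axis j (?\<mu> i)"
  have n: "n $ i = ?\<mu> j" "n $ j = ?\<mu> i" using ij by (auto simp: n_def axis_def)
  have P_H: "orth_proj h ?H w = ((w $ i + w $ j) / (?\<mu> i + ?\<mu> j)) *s n" for w
    using orth_proj_H_pair[OF \<mu> _ ij, where s=1 and w=w] by (simp add: h_eq n_def)
  define T where "T w = (\<Sum>K\<in>?S. \<kappa> K *s orth_proj h K w)" for w
  have "signed_point R ((\<lambda>_. 1)(i := 0, j := 0)) id \<in> ?H" by (simp add: signed_point_def H_pair_def)
  moreover have "axis i 1 - axis j 1 \<in> ?H" using ij by (simp add: H_pair_def axis_def)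
  moreover have "axis i 1 - axis j 1 \<notin> K" if "K \<in> ?S" for K
    using that ij by (auto simp: H_pair_def H_coord_def axis_def)
  ultimately have comm: "orth_proj h ?H (T w) = T (orth_proj h ?H w)" for w
    unfolding T_def
    using residue_commutes_B[OF H_pair_in_B[OF _ ij] _ _ hyperplanes_through_double_zero[OF R ij]] by blast
  have "orth_proj h ?H n = n"
    unfolding P_H n using mu_sum_nonzero[of i j] by (simp add: add.commute)
  then have "T n = orth_proj h ?H (T n)" using comm by simp
  then obtain x where x: "T n = x *s n" using P_H by metis
  have "H_coord i \<noteq> H_coord j" "H_coord i \<noteq> H_pair (-1) i j" "H_coord j \<noteq> H_pair (-1) i j"
    using axis_in_H_coord[of j i] axis_in_H_coord[of j j] axis_in_H_coord[of i j] axis_in_H_pair[of "-1" i j i]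
      axis_in_H_pair[of "-1" i j j] ij by auto
  then have "T n = \<kappa> (H_coord i) *s orth_proj h (H_coord i) n + (\<kappa> (H_coord j) *s orth_proj h (H_coord j) n
      + \<kappa> (H_pair (-1) i j) *s orth_proj h (H_pair (-1) i j) n)"
    by (simp add: T_def)
  also have "\<dots> = \<kappa> (H_coord i) *s axis i (?\<mu> j) + (\<kappa> (H_coord j) *s axis j (?\<mu> i)
      + (ratio (-1) i j * (?\<mu> j - ?\<mu> i)) *s (axis i (?\<mu> j) + axis j (- ?\<mu> i)))"
    using kappa_orth_proj_H_pair[OF _ ij, of "-1" n] by (simp add: h_eq orth_proj_H_coord[OF \<mu>] n)
  finally have Tn: "x *s n = \<kappa> (H_coord i) *s axis i (?\<mu> j) + (\<kappa> (H_coord j) *s axis j (?\<mu> i)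
      + (ratio (-1) i j * (?\<mu> j - ?\<mu> i)) *s (axis i (?\<mu> j) + axis j (- ?\<mu> i)))"
    unfolding x .
  have "x * ?\<mu> j = (\<kappa> (H_coord i) + ratio (-1) i j * (?\<mu> j - ?\<mu> i)) * ?\<mu> j"
    using arg_cong[OF Tn, of "\<lambda>y. y $ i"] ij n by (simp add: axis_def distrib_right)
  moreover have "x * ?\<mu> i = (\<kappa> (H_coord j) - ratio (-1) i j * (?\<mu> j - ?\<mu> i)) * ?\<mu> i"
    using arg_cong[OF Tn, of "\<lambda>y. y $ j"] ij n by (simp add: axis_def left_diff_distrib)
  ultimately have "x = \<kappa> (H_coord i) + ratio (-1) i j * (?\<mu> j - ?\<mu> i)"
    "x = \<kappa> (H_coord j) - ratio (-1) i j * (?\<mu> j - ?\<mu> i)"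
    using \<mu>[of i] \<mu>[of j] by simp_all
  then show ?thesis by algebra
qed

text \<open>By the triples, mirrors of long roots that share an index have equal ratios, and at rank at least
three any two of them are connected through mirrors sharing an index. The detour through a third index
also relates the two signs for the same pair.\<close>
lemma ratio_constant:
  assumes "s \<in> {1, -1}" "t \<in> {1, -1}" "i \<noteq> j" "k \<noteq> l"
  shows "ratio s i j = ratio t k l"
proof -
  have share: "ratio s p b = ratio t q b" if "s \<in> {1, -1}" "t \<in> {1, -1}" "p \<noteq> b" "q \<noteq> b" for s t p q b
  proof (cases "p = q")
    case True
    obtain r where r: "r \<noteq> p" "r \<noteq> b" using ex_third_index[OF n3] by blast
    then have "ratio s p b = ratio s r b" "ratio s r b = ratio t p b"
      using that by (auto intro: ratio_triple)
    then show ?thesis using True by simp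
  next
    case False
    then show ?thesis using that by (auto intro: ratio_triple)
  qed
  show ?thesis
  proof (cases "j = k")
    case True
    then show ?thesis using share[of s t i j l] ratio_commute[of t k l] assms by auto
  next
    case False
    then have "ratio s i j = ratio s k j" using share[of s s i j k] assms by auto
    also have "\<dots> = ratio s j k" using ratio_commute assms by auto
    also have "\<dots> = ratio t l k" using share[of s t j k l] assms False by auto
    finally show ?thesis using ratio_commute[of t l k] assms by auto
  qed
qed

text \<open>The common ratio is the factor of proportionality. After division by it, the exponent of \<open>z\<^sub>i = 0\<close>
minus \<open>2 \<mu>\<^sub>i\<close> does not depend on \<open>i\<close>, which defines \<open>a\<close>.\<close>
lemma exponents_proportional:
  obtains a c where "c \<noteq> 0" "B_exponents \<mu> a (\<lambda>H. \<kappa> H / c)"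
proof -
  let ?\<mu> = "\<lambda>i. complex_of_real (\<mu> i)"
  obtain i\<^sub>0 :: 'n where True by blast
  obtain j\<^sub>0 where j: "j\<^sub>0 \<noteq> i\<^sub>0" using ex_third_index[OF n3] by blast
  define c where "c = ratio 1 i\<^sub>0 j\<^sub>0"
  have c: "ratio s i j = c" if "s \<in> {1, -1}" "i \<noteq> j" for s i j
    unfolding c_def using ratio_constant[OF that(1) _ that(2), of 1 i\<^sub>0 j\<^sub>0] j by auto
  have "c \<noteq> 0"
    unfolding c_def ratio_def using \<kappa>[OF H_pair_in_B[of 1 i\<^sub>0 j\<^sub>0]] j mu_sum_nonzero by auto
  define a where "a = \<kappa> (H_coord i\<^sub>0) / c - 2 * ?\<mu> i\<^sub>0"
  have "\<kappa> (H_coord i) / c = a + 2 * ?\<mu> i" for i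
  proof (cases "i = i\<^sub>0")
    case True
    then show ?thesis by (simp add: a_def)
  next
    case False
    then have "\<kappa> (H_coord i) - \<kappa> (H_coord i\<^sub>0) = 2 * c * (?\<mu> i - ?\<mu> i\<^sub>0)"
      using kappa_H_coord_diff[OF False] c[of "-1" i i\<^sub>0] by simp
    then have "\<kappa> (H_coord i) = \<kappa> (H_coord i\<^sub>0) + 2 * c * (?\<mu> i - ?\<mu> i\<^sub>0)"
      by (simp add: diff_eq_eq add.commute)
    then show ?thesis using \<open>c \<noteq> 0\<close> by (simp add: a_def add_divide_distrib diff_divide_distrib right_diff_distrib)
  qed
  then have "B_exponents \<mu> a (\<lambda>H. \<kappa> H / c)"
    unfolding B_exponents_def H_plus_eq_H_pair H_minus_eq_H_pair
    using c \<open>c \<noteq> 0\<close> by (simp add: kappa_H_pair)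
  with \<open>c \<noteq> 0\<close> show ?thesis by (rule that)
qed

end

lemma dunkl_form_B_classification:
  obtains \<mu> a \<kappa>' c where "\<And>i. \<mu> i > 0" "B_exponents \<mu> a \<kappa>'" "c \<noteq> 0"
    "\<And>z v w. Omega h B_arrangement \<kappa> z v w = c *s Omega (diag_inner \<mu>) B_arrangement \<kappa>' z v w"
proof -
  obtain \<mu> where \<mu>: "\<And>i. \<mu> i > 0" "h = diag_inner \<mu>" using diagonal_inner_product by blast
  obtain a c where c: "c \<noteq> 0" "B_exponents \<mu> a (\<lambda>H. \<kappa> H / c)" using exponents_proportional[OF \<mu>] by blast
  have "Omega h B_arrangement \<kappa> z v w = c *s Omega (diag_inner \<mu>) B_arrangement (\<lambda>H. \<kappa> H / c) z v w" for z v w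
    using c(1) by (simp add: Omega_def \<mu>(2) vec_eq_iff sum_distrib_left)
  with \<mu>(1) c show ?thesis by (intro that)
qed

end

theorem proposition2p25:
  assumes "CARD('n::finite) \<ge> 3"
  shows
    "(\<forall>(\<mu> :: 'n \<Rightarrow> real) (a :: complex) \<kappa>.
        (\<forall>i. \<mu> i > 0) \<and> B_exponents \<mu> a \<kappa> \<longrightarrow>
          dunkl_form (diag_inner \<mu>) B_arrangement \<kappa> \<and>
          kappa_0 B_arrangement \<kappa> = a + 2 * (\<Sum>i\<in>UNIV. complex_of_real (\<mu> i))) \<and>
     (\<forall>(h :: complex^'n \<Rightarrow> complex^'n \<Rightarrow> complex) \<kappa>.
        dunkl_form h B_arrangement \<kappa> \<and> (\<forall>H\<in>B_arrangement. \<kappa> H \<noteq> 0) \<longrightarrow>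
          (\<exists>(\<mu> :: 'n \<Rightarrow> real) (a :: complex) \<kappa>' (c :: complex).
             (\<forall>i. \<mu> i > 0) \<and> B_exponents \<mu> a \<kappa>' \<and> c \<noteq> 0 \<and>
             (\<forall>z\<in>arr_complement B_arrangement. \<forall>v w.
                Omega h B_arrangement \<kappa> z v w
                  = c *s Omega (diag_inner \<mu>) B_arrangement \<kappa>' z v w)) \<and>
          (\<forall>i. form_invariant_on (arr_complement B_arrangement) (sign_change i)
                 (Omega h B_arrangement \<kappa>)))"
proof (intro conjI allI impI)
  fix \<mu> :: "'n \<Rightarrow> real" and a \<kappa>
  assume "(\<forall>i. \<mu> i > 0) \<and> B_exponents \<mu> a \<kappa>"
  then show "dunkl_form (diag_inner \<mu>) B_arrangement \<kappa>"
    and "kappa_0 B_arrangement \<kappa> = a + 2 * (\<Sum>i\<in>UNIV. complex_of_real (\<mu> i))"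
    using dunkl_form_B kappa_0_B by blast+
next
  fix h :: "complex^'n \<Rightarrow> complex^'n \<Rightarrow> complex" and \<kappa>
  assume dunkl: "dunkl_form h B_arrangement \<kappa> \<and> (\<forall>H\<in>B_arrangement. \<kappa> H \<noteq> 0)"
  then obtain \<mu> a \<kappa>' c where *: "\<And>i. \<mu> i > 0" "B_exponents \<mu> a \<kappa>'" "c \<noteq> 0"
    "\<And>z v w. Omega h B_arrangement \<kappa> z v w = c *s Omega (diag_inner \<mu>) B_arrangement \<kappa>' z v w"
    using dunkl_form_B_classification[of h \<kappa>] assms by blast
  then show "\<exists>(\<mu> :: 'n \<Rightarrow> real) (a :: complex) \<kappa>' (c :: complex).
             (\<forall>i. \<mu> i > 0) \<and> B_exponents \<mu> a \<kappa>' \<and> c \<noteq> 0 \<and>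
             (\<forall>z\<in>arr_complement B_arrangement. \<forall>v w.
                Omega h B_arrangement \<kappa> z v w
                  = c *s Omega (diag_inner \<mu>) B_arrangement \<kappa>' z v w)"
    by blast
  fix i
  have "form_invariant_on (arr_complement B_arrangement) (sign_change i) (Omega (diag_inner \<mu>) B_arrangement \<kappa>')"
    using form_invariant_B[OF *(1,2)] .
  moreover have "sign_change i (c *s x) = c *s sign_change i x" for x
    by (simp add: vec_eq_iff sign_change_def)
  ultimately show "form_invariant_on (arr_complement B_arrangement) (sign_change i) (Omega h B_arrangement \<kappa>)"
    by (simp add: form_invariant_on_def *(4))
qed

end
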